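(* Let $\Gamma$ be a group generated by a finite set $S$, let $(\Gamma_n)_n$ be a nested Farber sequence of finite index subgroups of $\Gamma$, and let $\mathfrak u$ be a non-principal ultrafilter on $\mathbb N$. Let $a_n$ be the action $\Gamma\curvearrowright\Gamma/\Gamma_n$ (with the uniform probability measure on $\Gamma/\Gamma_n$) and $a_{\mathfrak u}$ their ultraproduct action. Then $$\mathcal C(a_{\mathfrak u})=c\mathcal C_{\mathfrak u}((a_n)_n)=c\mathcal C\big((\mathrm{Sch}(\Gamma/\Gamma_n,S))_n\big)=\lim_{n\to\infty}\mathcal C(a_n).$$
   Context: A Farber sequence is a sequence $(\Gamma_n)_n$ of finite index subgroups of $\Gamma$ such that for every $\gamma\in\Gamma\setminus\{1\}$, $\frac{|\{g\Gamma_n\in\Gamma/\Gamma_n:\ \gamma\in g\Gamma_ng^{-1}\}|}{[\Gamma:\Gamma_n]}\to0$ as $n\to\infty$. It is nested if $\Gamma_n\geq\Gamma_{n+1}$ for all $n$. $\mathrm{Sch}(\Gamma/\Gamma_n,S)$ is the Schreier graph with vertex set $\Gamma/\Gamma_n$ and edges joining $x$ to $sx$, $s\in S$. Cost of an action. For a p.m.p. action $a:\Gamma\curvearrowright(X,\mu)$ on a (not necessarily standard) probability space, $\mathcal G_a=\Gamma\times X$ is the groupoid with unit space $X\simeq\{1\}\times X$, $s(\gamma,x)=x$, $t(\gamma,x)=\gamma x$, $(\gamma,x)(\gamma',x')=(\gamma\gamma',x')$ when $\gamma'x'=x$, with the product $\sigma$-algebra and the measure $\tilde\mu=$ (counting)$\times\mu$.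 A bisection is a measurable subset on which $s$ and $t$ are injective; products of bisections are $\varphi\psi=\{gh:g\in\varphi,h\in\psi,s(g)=t(h)\}$. A graphing is an at most countable family $\Phi=(\varphi_i)$ of bisections, with cost $\mathcal C(\Phi)=\sum_i\tilde\mu(\varphi_i)$. It is generating if the smallest subgroupoid containing it is $\mathcal G_a$ up to null sets. $\mathcal C(a)=\inf\{\mathcal C(\Phi):\Phi\text{ generating}\}$ (groupoid cost). For the action on $\Gamma/\Gamma_n$ one has $\mathcal C(a_n)=1+\frac{\mathrm{rank}(\Gamma_n)-1}{[\Gamma:\Gamma_n]}$, where $\mathrm{rank}$ is the minimal number of generators. Combinatorial costs. For finite graphings $\Phi,\Psi$ of a groupoid $\mathcal G$ and $L\in\mathbb N$, write $\Psi\subset_L\Phi$ if each $\psi\in\Psi$ is, up to null sets, contained in the union of the products of at most $L$ elements of $\Phi\cup\Phi^{-1}$. They are $L$-Lipschitz equivalent if $\Psi\subset_L\Phi$ and $\Phi\subset_L\Psi$. $\mathcal C_L(\mathcal G,\Phi)$ is the infimum of $\mathcal C(\Psi)$ over all $\Psi$ $L$-Lipschitz equivalent to $\Phi$. $c\mathcal C_{\mathfrak u}((a_n)_n)=\inf_L\lim_{n\in\mathfrak u}\mathcal C_L(\mathcal G_{a_n},(\{s\}\times\Gamma/\Gamma_n)_{s\in S})$. For a sequence of finite graphs $G_n$ with vertex sets $V_n$ and uniformly bounded degrees, $c\mathcal C((G_n)_n)=\inf_L\liminf_{n\to\infty}\mathcal C_L(G_n)$, where $\mathcal C_L(G_n)$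 is the infimum of $|E(H)|/|V_n|$ over graphs $H$ on $V_n$ such that endpoints of edges of $H$ are at $G_n$-distance at most $L$ and endpoints of edges of $G_n$ are at $H$-distance at most $L$. Ultraproduct action. $X_{\mathfrak u}=\prod_n(\Gamma/\Gamma_n)/\!\sim_{\mathfrak u}$ (sequences equal for $\mathfrak u$-almost every $n$ identified), with the Loeb probability measure, $\mu_{\mathfrak u}([A_n]_{\mathfrak u})=\lim_{n\in\mathfrak u}|A_n|/[\Gamma:\Gamma_n]$, every measurable set being of the form $[A_n]_{\mathfrak u}$ up to a null set; $\gamma[x_n]_{\mathfrak u}=[\gamma x_n]_{\mathfrak u}$. *)

theory Defs
  imports
    "HOL-Algebra.Generated_Groups"
    "HOL-Algebra.Left_Coset"
    "HOL-Probability.Probability_Measure"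
    "HOL-Library.Extended_Nat"
begin

section \<open>Measured groupoids, graphings and cost\<close>

record ('e, 'x) pm_groupoid =
  arrows :: "'e measure"
  units :: "'e set"
  src :: "'e \<Rightarrow> 'x"
  tgt :: "'e \<Rightarrow> 'x"
  gmult :: "'e \<Rightarrow> 'e \<Rightarrow> 'e"
  ginv :: "'e \<Rightarrow> 'e"

text \<open>The product \<open>gmult \<G> g h\<close> is meaningful only when \<open>src \<G> g = tgt \<G> h\<close>.\<close>

definition action_groupoid ::
  "('g, 'b) monoid_scheme \<Rightarrow> 'x measure \<Rightarrow> ('g \<Rightarrow> 'x \<Rightarrow> 'x) \<Rightarrow> ('g \<times> 'x, 'x) pm_groupoid" where
  "action_groupoid G M a =
    \<lparr> arrows = count_space (carrier G) \<Otimes>\<^sub>M M,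
      units = {\<one>\<^bsub>G\<^esub>} \<times> space M,
      src = (\<lambda>(g, x). x),
      tgt = (\<lambda>(g, x). a g x),
      gmult = (\<lambda>(g, x) (g', x'). (g \<otimes>\<^bsub>G\<^esub> g', x')),
      ginv = (\<lambda>(g, x). (inv\<^bsub>G\<^esub> g, a g x)) \<rparr>"

definition bisection :: "('e, 'x) pm_groupoid \<Rightarrow> 'e set \<Rightarrow> bool" where
  "bisection \<G> \<phi> \<longleftrightarrow>
    \<phi> \<in> sets (arrows \<G>) \<and> inj_on (src \<G>) \<phi> \<and> inj_on (tgt \<G>) \<phi>"

text \<open>
  A graphing is a family \<open>(\<phi> i)\<close> indexed by \<open>i \<in> I\<close>; repetitions are allowed and
  contribute to the cost.
\<close>

definition graphing :: "('e, 'x) pm_groupoid \<Rightarrow> 'i set \<Rightarrow> ('i \<Rightarrow> 'e set) \<Rightarrow> bool" where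
  "graphing \<G> I \<phi> \<longleftrightarrow> countable I \<and> (\<forall>i\<in>I. bisection \<G> (\<phi> i))"

definition graphing_cost :: "('e, 'x) pm_groupoid \<Rightarrow> 'i set \<Rightarrow> ('i \<Rightarrow> 'e set) \<Rightarrow> ennreal" where
  "graphing_cost \<G> I \<phi> = (\<Sum>\<^sub>\<infinity>i\<in>I. emeasure (arrows \<G>) (\<phi> i))"

text \<open>
  Subgroupoids are wide: they contain every unit. In particular the empty graphing generates
  the groupoid of the trivial group acting on a point, which has cost \<open>0\<close>.
\<close>

definition subgroupoid :: "('e, 'x) pm_groupoid \<Rightarrow> 'e set \<Rightarrow> bool" where
  "subgroupoid \<G> K \<longleftrightarrow>
    K \<subseteq> space (arrows \<G>) \<and> units \<G> \<subseteq> K \<and>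
    (\<forall>g\<in>K. \<forall>h\<in>K. src \<G> g = tgt \<G> h \<longrightarrow> gmult \<G> g h \<in> K) \<and>
    (\<forall>g\<in>K. ginv \<G> g \<in> K)"

definition generated_subgroupoid :: "('e, 'x) pm_groupoid \<Rightarrow> 'e set \<Rightarrow> 'e set" where
  "generated_subgroupoid \<G> A = \<Inter>{K. subgroupoid \<G> K \<and> A \<subseteq> K}"

definition generating :: "('e, 'x) pm_groupoid \<Rightarrow> 'i set \<Rightarrow> ('i \<Rightarrow> 'e set) \<Rightarrow> bool" where
  "generating \<G> I \<phi> \<longleftrightarrow>
    (AE g in arrows \<G>. g \<in> generated_subgroupoid \<G> (\<Union>i\<in>I. \<phi> i))"

text \<open>Every at most countable family can be indexed by a set of natural numbers.\<close>

definition groupoid_cost :: "('e, 'x) pm_groupoid \<Rightarrow> ennreal" where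
  "groupoid_cost \<G> =
    (INF (I, \<phi>) \<in> {(I :: nat set, \<phi>). graphing \<G> I \<phi> \<and> generating \<G> I \<phi>}.
      graphing_cost \<G> I \<phi>)"

definition action_cost ::
  "('g, 'b) monoid_scheme \<Rightarrow> 'x measure \<Rightarrow> ('g \<Rightarrow> 'x \<Rightarrow> 'x) \<Rightarrow> ennreal" where
  "action_cost G M a = groupoid_cost (action_groupoid G M a)"


section \<open>Combinatorial cost of a sequence of actions\<close>

definition set_product :: "('e, 'x) pm_groupoid \<Rightarrow> 'e set \<Rightarrow> 'e set \<Rightarrow> 'e set" where
  "set_product \<G> A B = {gmult \<G> g h |g h. g \<in> A \<and> h \<in> B \<and> src \<G> g = tgt \<G> h}"

text \<open>The empty product is the set of units.\<close>

definition bounded_products :: "('e, 'x) pm_groupoid \<Rightarrow> nat \<Rightarrow> 'i set \<Rightarrow> ('i \<Rightarrow> 'e set) \<Rightarrow> 'e set" where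
  "bounded_products \<G> L I \<phi> =
    \<Union>{foldr (set_product \<G>) ws (units \<G>) |ws.
        length ws \<le> L \<and> set ws \<subseteq> \<phi> ` I \<union> (\<lambda>i. ginv \<G> ` \<phi> i) ` I}"

definition lipschitz_subordinate ::
  "('e, 'x) pm_groupoid \<Rightarrow> nat \<Rightarrow> 'j set \<Rightarrow> ('j \<Rightarrow> 'e set) \<Rightarrow> 'i set \<Rightarrow> ('i \<Rightarrow> 'e set) \<Rightarrow> bool" where
  "lipschitz_subordinate \<G> L J \<psi> I \<phi> \<longleftrightarrow>
    (\<forall>j\<in>J. AE g in arrows \<G>. g \<in> \<psi> j \<longrightarrow> g \<in> bounded_products \<G> L I \<phi>)"

definition lipschitz_equivalent ::
  "('e, 'x) pm_groupoid \<Rightarrow> nat \<Rightarrow> 'j set \<Rightarrow> ('j \<Rightarrow> 'e set) \<Rightarrow> 'i set \<Rightarrow> ('i \<Rightarrow> 'e set) \<Rightarrow> bool" where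
  "lipschitz_equivalent \<G> L J \<psi> I \<phi> \<longleftrightarrow>
    lipschitz_subordinate \<G> L J \<psi> I \<phi> \<and> lipschitz_subordinate \<G> L I \<phi> J \<psi>"

definition lipschitz_cost ::
  "nat \<Rightarrow> ('e, 'x) pm_groupoid \<Rightarrow> 'i set \<Rightarrow> ('i \<Rightarrow> 'e set) \<Rightarrow> ennreal" where
  "lipschitz_cost L \<G> I \<phi> =
    (INF (J, \<psi>) \<in> {(J :: nat set, \<psi>). finite J \<and> graphing \<G> J \<psi> \<and> lipschitz_equivalent \<G> L J \<psi> I \<phi>}.
      graphing_cost \<G> J \<psi>)"

text \<open>
  Limits along an ultrafilter always exist in the compact Hausdorff space \<open>ennreal\<close>, so
  \<^const>\<open>Lim\<close> is meaningful here (see \<open>ultrafilter_tendsto_Lim\<close> below).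
\<close>

definition ultra_combinatorial_cost ::
  "nat filter \<Rightarrow> ('g, 'b) monoid_scheme \<Rightarrow> 'g set \<Rightarrow> (nat \<Rightarrow> 'x measure) \<Rightarrow>
    (nat \<Rightarrow> 'g \<Rightarrow> 'x \<Rightarrow> 'x) \<Rightarrow> ennreal" where
  "ultra_combinatorial_cost \<uu> G S M a =
    (INF L. Lim \<uu> (\<lambda>n. lipschitz_cost L (action_groupoid G (M n) (a n)) S (\<lambda>s. {s} \<times> space (M n))))"


section \<open>Combinatorial cost of a sequence of finite graphs\<close>

text \<open>
  A graph on a vertex set \<open>V\<close> is given by its set \<open>E\<close> of undirected edges \<open>{x, y}\<close>; loops are
  singletons. Multiple edges are not recorded, as they play no role for distances.
\<close>

definition graph_on :: "'v set \<Rightarrow> 'v set set \<Rightarrow> bool" where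
  "graph_on V E \<longleftrightarrow> E \<subseteq> {{x, y} |x y. x \<in> V \<and> y \<in> V}"

definition graph_dist :: "'v set set \<Rightarrow> 'v \<Rightarrow> 'v \<Rightarrow> enat" where
  "graph_dist E x y = (INF k \<in> {k. (x, y) \<in> {(v, w). {v, w} \<in> E} ^^ k}. enat k)"

definition graph_lipschitz_cost :: "nat \<Rightarrow> 'v set \<Rightarrow> 'v set set \<Rightarrow> ennreal" where
  "graph_lipschitz_cost L V E =
    (INF F \<in> {F. graph_on V F \<and>
        (\<forall>x y. {x, y} \<in> F \<longrightarrow> graph_dist E x y \<le> enat L) \<and>
        (\<forall>x y. {x, y} \<in> E \<longrightarrow> graph_dist F x y \<le> enat L)}.
      ennreal (real (card F) / real (card V)))"

definition combinatorial_cost :: "(nat \<Rightarrow> 'v set) \<Rightarrow> (nat \<Rightarrow> 'v set set) \<Rightarrow> ennreal" where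
  "combinatorial_cost V E = (INF L. liminf (\<lambda>n. graph_lipschitz_cost L (V n) (E n)))"


section \<open>Farber sequences, coset actions and Schreier graphs\<close>

definition farber_sequence :: "('g, 'b) monoid_scheme \<Rightarrow> (nat \<Rightarrow> 'g set) \<Rightarrow> bool" where
  "farber_sequence G H \<longleftrightarrow>
    (\<forall>n. subgroup (H n) G \<and> finite (lcosets\<^bsub>G\<^esub> (H n))) \<and>
    (\<forall>\<gamma>\<in>carrier G - {\<one>\<^bsub>G\<^esub>}.
      (\<lambda>n. real (card {g <#\<^bsub>G\<^esub> H n |g. g \<in> carrier G \<and> \<gamma> \<in> (g <#\<^bsub>G\<^esub> H n) #>\<^bsub>G\<^esub> (inv\<^bsub>G\<^esub> g)})
          / real (card (lcosets\<^bsub>G\<^esub> (H n)))) \<longlonglongrightarrow> 0)"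

definition nested_sequence :: "(nat \<Rightarrow> 'g set) \<Rightarrow> bool" where
  "nested_sequence H \<longleftrightarrow> (\<forall>n. H (Suc n) \<subseteq> H n)"

definition coset_measure :: "('g, 'b) monoid_scheme \<Rightarrow> 'g set \<Rightarrow> 'g set measure" where
  "coset_measure G K = uniform_count_measure (lcosets\<^bsub>G\<^esub> K)"

text \<open>
  Translation of left cosets: \<open>\<gamma> (g K) = (\<gamma> g) K\<close>, the set-level translate of \<open>g K\<close> by \<open>\<gamma>\<close>.
\<close>

definition coset_action :: "('g, 'b) monoid_scheme \<Rightarrow> 'g \<Rightarrow> 'g set \<Rightarrow> 'g set" where
  "coset_action G \<gamma> x = \<gamma> <#\<^bsub>G\<^esub> x"

definition schreier_edges :: "('g, 'b) monoid_scheme \<Rightarrow> 'g set \<Rightarrow> 'g set \<Rightarrow> 'g set set set" where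
  "schreier_edges G K S = {{x, coset_action G s x} |x s. x \<in> lcosets\<^bsub>G\<^esub> K \<and> s \<in> S}"


section \<open>Ultraproducts and the Loeb measure\<close>

definition nonprincipal_ultrafilter :: "'i filter \<Rightarrow> bool" where
  "nonprincipal_ultrafilter \<uu> \<longleftrightarrow>
    \<uu> \<noteq> bot \<and> (\<forall>P. eventually P \<uu> \<or> eventually (\<lambda>i. \<not> P i) \<uu>) \<and> (\<forall>i. \<uu> \<noteq> principal {i})"

definition ultra_rel :: "nat filter \<Rightarrow> (nat \<Rightarrow> 'x set) \<Rightarrow> ((nat \<Rightarrow> 'x) \<times> (nat \<Rightarrow> 'x)) set" where
  "ultra_rel \<uu> X = {(x, y). x \<in> Pi UNIV X \<and> y \<in> Pi UNIV X \<and> (\<forall>\<^sub>F n in \<uu>. x n = y n)}"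

definition ultraproduct :: "nat filter \<Rightarrow> (nat \<Rightarrow> 'x set) \<Rightarrow> (nat \<Rightarrow> 'x) set set" where
  "ultraproduct \<uu> X = Pi UNIV X // ultra_rel \<uu> X"

definition internal_set ::
  "nat filter \<Rightarrow> (nat \<Rightarrow> 'x set) \<Rightarrow> (nat \<Rightarrow> 'x set) \<Rightarrow> (nat \<Rightarrow> 'x) set set" where
  "internal_set \<uu> X A = {c \<in> ultraproduct \<uu> X. \<exists>x\<in>c. \<forall>\<^sub>F n in \<uu>. x n \<in> A n}"

text \<open>
  The Loeb measure is the completed Caratheodory extension of
  \<open>[A n]\<^sub>\<uu> \<mapsto> lim\<^sub>\<uu> (\<mu> n (A n))\<close> from the algebra of internal sets; its measurable sets are
  the sets that agree with an internal set up to a null set.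
\<close>

definition loeb_outer ::
  "nat filter \<Rightarrow> (nat \<Rightarrow> 'x measure) \<Rightarrow> (nat \<Rightarrow> 'x) set set \<Rightarrow> ennreal" where
  "loeb_outer \<uu> M B =
    (INF A \<in> {A. (\<forall>n. A n \<in> sets (M n)) \<and> B \<subseteq> internal_set \<uu> (\<lambda>n. space (M n)) A}.
      Lim \<uu> (\<lambda>n. emeasure (M n) (A n)))"

definition loeb_sets ::
  "nat filter \<Rightarrow> (nat \<Rightarrow> 'x measure) \<Rightarrow> (nat \<Rightarrow> 'x) set set set" where
  "loeb_sets \<uu> M =
    {B. B \<subseteq> ultraproduct \<uu> (\<lambda>n. space (M n)) \<and>
      (\<exists>A. (\<forall>n. A n \<in> sets (M n)) \<and>
        loeb_outer \<uu> M (sym_diff B (internal_set \<uu> (\<lambda>n. space (M n)) A)) = 0)}"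

definition loeb_measure ::
  "nat filter \<Rightarrow> (nat \<Rightarrow> 'x measure) \<Rightarrow> (nat \<Rightarrow> 'x) set measure" where
  "loeb_measure \<uu> M =
    measure_of (ultraproduct \<uu> (\<lambda>n. space (M n))) (loeb_sets \<uu> M) (loeb_outer \<uu> M)"

text \<open>\<open>\<gamma> [x n]\<^sub>\<uu> = [\<gamma> (x n)]\<^sub>\<uu>\<close>, as an operation on equivalence classes.\<close>

definition ultraproduct_action ::
  "nat filter \<Rightarrow> (nat \<Rightarrow> 'x measure) \<Rightarrow> (nat \<Rightarrow> 'g \<Rightarrow> 'x \<Rightarrow> 'x) \<Rightarrow>
    'g \<Rightarrow> (nat \<Rightarrow> 'x) set \<Rightarrow> (nat \<Rightarrow> 'x) set" where
  "ultraproduct_action \<uu> M a \<gamma> c =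
    (\<Union>x\<in>c. ultra_rel \<uu> (\<lambda>n. space (M n)) `` {\<lambda>n. a n \<gamma> (x n)})"


subsection \<open>Limits along ultrafilters and the Loeb measure are well defined\<close>

lemma ultrafilter_tendsto_Lim:
  fixes f :: "nat \<Rightarrow> ennreal"
  assumes "nonprincipal_ultrafilter \<uu>"
  shows "(f \<longlongrightarrow> Lim \<uu> f) \<uu>"
proof -
  have nb: "\<uu> \<noteq> bot" and ultra: "\<And>P. eventually P \<uu> \<or> eventually (\<lambda>i. \<not> P i) \<uu>"
    using assms by (auto simp: nonprincipal_ultrafilter_def)
  have "Limsup \<uu> f \<le> Liminf \<uu> f"
  proof (rule ccontr)
    assume "\<not> Limsup \<uu> f \<le> Liminf \<uu> f"
    then obtain y where y: "Liminf \<uu> f < y" "y < Limsup \<uu> f"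
      using dense[of "Liminf \<uu> f" "Limsup \<uu> f"] by (auto simp: not_le)
    from ultra[of "\<lambda>n. f n \<le> y"] show False
    proof
      assume "\<forall>\<^sub>F n in \<uu>. f n \<le> y"
      then have "Limsup \<uu> f \<le> y" by (rule Limsup_bounded)
      with y show False by auto
    next
      assume "\<forall>\<^sub>F n in \<uu>. \<not> f n \<le> y"
      then have "\<forall>\<^sub>F n in \<uu>. y \<le> f n" by (rule eventually_mono) auto
      then have "y \<le> Liminf \<uu> f" by (rule Liminf_bounded)
      with y show False by auto
    qed
  qed
  then have "Liminf \<uu> f = Limsup \<uu> f"
    using Liminf_le_Limsup[OF nb, of f] by (rule antisym[rotated])
  then have "(f \<longlongrightarrow> Limsup \<uu> f) \<uu>"
    by (intro Liminf_eq_Limsup nb) auto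
  then show ?thesis
    using tendsto_Lim[OF nb] by metis
qed

lemma nonprincipal_ultrafilter_eventually_ge:
  assumes "nonprincipal_ultrafilter \<uu>"
  shows "eventually (\<lambda>n::nat. n \<ge> k) \<uu>"
proof -
  have nb: "\<uu> \<noteq> bot" and ultra: "\<And>P. eventually P \<uu> \<or> eventually (\<lambda>i. \<not> P i) \<uu>"
    and np: "\<And>i. \<uu> \<noteq> principal {i}"
    using assms by (auto simp: nonprincipal_ultrafilter_def)
  have ne: "eventually (\<lambda>n. n \<noteq> i) \<uu>" for i
  proof (rule ccontr)
    assume "\<not> eventually (\<lambda>n. n \<noteq> i) \<uu>"
    with ultra[of "\<lambda>n. n \<noteq> i"] have e: "eventually (\<lambda>n. n = i) \<uu>" by simp
    have "eventually P \<uu> \<longleftrightarrow> P i" for P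
    proof
      assume "eventually P \<uu>"
      with e have "eventually (\<lambda>n. P i) \<uu>" by eventually_elim auto
      then show "P i" using nb by (simp add: eventually_const_iff)
    next
      assume "P i"
      with e show "eventually P \<uu>" by (auto elim: eventually_mono)
    qed
    then have "\<uu> = principal {i}"
      by (auto simp: filter_eq_iff eventually_principal)
    with np show False by blast
  qed
  have "eventually (\<lambda>n. \<forall>i\<in>{..<k}. n \<noteq> i) \<uu>"
    by (rule eventually_ball_finite) (auto intro: ne)
  then show ?thesis
    by (rule eventually_mono) (auto simp: not_less[symmetric])
qed

locale loeb_space =
  fixes \<uu> :: "nat filter" and M :: "nat \<Rightarrow> 'x measure"
  assumes u: "nonprincipal_ultrafilter \<uu>"
    and prob: "\<And>n. prob_space (M n)"
begin

abbreviation "X \<equiv> ultraproduct \<uu> (\<lambda>n. space (M n))"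
abbreviation "I A \<equiv> internal_set \<uu> (\<lambda>n. space (M n)) A"
definition "msets = {A. \<forall>n. A n \<in> sets (M n)}"
definition "m A = Lim \<uu> (\<lambda>n. emeasure (M n) (A n))"

lemma nb: "\<uu> \<noteq> bot" and ultra: "eventually P \<uu> \<or> eventually (\<lambda>i. \<not> P i) \<uu>"
  using u by (auto simp: nonprincipal_ultrafilter_def)

lemma eventually_not_iff: "eventually (\<lambda>i. \<not> P i) \<uu> \<longleftrightarrow> \<not> eventually P \<uu>"
proof
  assume "eventually (\<lambda>i. \<not> P i) \<uu>"
  show "\<not> eventually P \<uu>"
  proof
    assume "eventually P \<uu>"
    with \<open>eventually (\<lambda>i. \<not> P i) \<uu>\<close> have "eventually (\<lambda>i. False) \<uu>"
      by eventually_elim simp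
    with nb show False by (simp add: eventually_False)
  qed
qed (use ultra[of P] in blast)

lemma m_tendsto: "((\<lambda>n. emeasure (M n) (A n)) \<longlongrightarrow> m A) \<uu>"
  unfolding m_def by (rule ultrafilter_tendsto_Lim[OF u])

lemma mI: "((\<lambda>n. emeasure (M n) (A n)) \<longlongrightarrow> l) \<uu> \<Longrightarrow> m A = l"
  using m_tendsto nb tendsto_unique by blast

lemma quotE:
  assumes "c \<in> X"
  obtains x where "x \<in> Pi UNIV (\<lambda>n. space (M n))" "c = ultra_rel \<uu> (\<lambda>n. space (M n)) `` {x}"
  using assms unfolding ultraproduct_def by (auto elim: quotientE)

lemma internal_class:
  assumes "x \<in> Pi UNIV (\<lambda>n. space (M n))"
  shows "ultra_rel \<uu> (\<lambda>n. space (M n)) `` {x} \<in> I A \<longleftrightarrow> (\<forall>\<^sub>F n in \<uu>. x n \<in> A n)"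
proof -
  have 1: "ultra_rel \<uu> (\<lambda>n. space (M n)) `` {x} \<in> X"
    using assms unfolding ultraproduct_def by (rule quotientI)
  have "(\<exists>y\<in>ultra_rel \<uu> (\<lambda>n. space (M n)) `` {x}. \<forall>\<^sub>F n in \<uu>. y n \<in> A n) \<longleftrightarrow> (\<forall>\<^sub>F n in \<uu>. x n \<in> A n)"
  proof
    assume "\<exists>y\<in>ultra_rel \<uu> (\<lambda>n. space (M n)) `` {x}. \<forall>\<^sub>F n in \<uu>. y n \<in> A n"
    then obtain y where "\<forall>\<^sub>F n in \<uu>. x n = y n" "\<forall>\<^sub>F n in \<uu>. y n \<in> A n"
      by (auto simp: ultra_rel_def)
    then show "\<forall>\<^sub>F n in \<uu>. x n \<in> A n" by eventually_elim auto
  next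
    assume "\<forall>\<^sub>F n in \<uu>. x n \<in> A n"
    moreover have "x \<in> ultra_rel \<uu> (\<lambda>n. space (M n)) `` {x}"
      using assms by (auto simp: ultra_rel_def)
    ultimately show "\<exists>y\<in>ultra_rel \<uu> (\<lambda>n. space (M n)) `` {x}. \<forall>\<^sub>F n in \<uu>. y n \<in> A n" by blast
  qed
  with 1 show ?thesis by (simp add: internal_set_def)
qed

lemma I_sub: "I A \<subseteq> X" by (auto simp: internal_set_def)

lemma I_space: "I (\<lambda>n. space (M n)) = X"
proof -
  have "c \<in> I (\<lambda>n. space (M n))" if "c \<in> X" for c
    using that by (rule quotE) (auto simp: internal_class Pi_iff)
  then show ?thesis using I_sub by blast
qed

lemma I_empty: "I (\<lambda>n. {}) = {}"
  using nb by (auto simp: internal_set_def)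

lemma class_setI: assumes "A \<subseteq> X" "B \<subseteq> X"
  "\<And>x. x \<in> Pi UNIV (\<lambda>n. space (M n)) \<Longrightarrow>
     ultra_rel \<uu> (\<lambda>n. space (M n)) `` {x} \<in> A \<longleftrightarrow> ultra_rel \<uu> (\<lambda>n. space (M n)) `` {x} \<in> B"
  shows "A = B"
proof -
  have "c \<in> A \<longleftrightarrow> c \<in> B" if "c \<in> X" for c
    using that by (rule quotE) (use assms(3) in auto)
  then show ?thesis using assms by blast
qed

lemma I_Un: "I (\<lambda>n. A n \<union> B n) = I A \<union> I B"
proof (rule class_setI)
  fix x assume x: "x \<in> Pi UNIV (\<lambda>n. space (M n))"
  have "(\<forall>\<^sub>F n in \<uu>. x n \<in> A n \<or> x n \<in> B n) \<longleftrightarrow> (\<forall>\<^sub>F n in \<uu>. x n \<in> A n) \<or> (\<forall>\<^sub>F n in \<uu>. x n \<in> B n)"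
  proof
    assume *: "\<forall>\<^sub>F n in \<uu>. x n \<in> A n \<or> x n \<in> B n"
    show "(\<forall>\<^sub>F n in \<uu>. x n \<in> A n) \<or> (\<forall>\<^sub>F n in \<uu>. x n \<in> B n)"
      using ultra[of "\<lambda>n. x n \<in> A n"]
    proof
      assume "\<forall>\<^sub>F n in \<uu>. x n \<notin> A n"
      with * have "\<forall>\<^sub>F n in \<uu>. x n \<in> B n" by eventually_elim auto
      then show ?thesis ..
    qed simp
  qed (auto elim: eventually_mono)
  then show "ultra_rel \<uu> (\<lambda>n. space (M n)) `` {x} \<in> I (\<lambda>n. A n \<union> B n) \<longleftrightarrow>
     ultra_rel \<uu> (\<lambda>n. space (M n)) `` {x} \<in> I A \<union> I B"
    using x by (simp add: internal_class)
qed (use I_sub in blast)+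

lemma I_Int: "I (\<lambda>n. A n \<inter> B n) = I A \<inter> I B"
  by (rule class_setI) (use I_sub in \<open>auto simp: internal_class eventually_conj_iff\<close>)

lemma I_Diff: "I (\<lambda>n. A n - B n) = I A - I B"
  by (rule class_setI) (use I_sub in \<open>auto simp: internal_class eventually_conj_iff eventually_not_iff\<close>)

lemma I_mono: "(\<forall>\<^sub>F n in \<uu>. A n \<subseteq> B n) \<Longrightarrow> I A \<subseteq> I B"
proof
  fix c assume A: "\<forall>\<^sub>F n in \<uu>. A n \<subseteq> B n" and c: "c \<in> I A"
  then have "c \<in> X" using I_sub by blast
  then show "c \<in> I B"
  proof (rule quotE)
    fix x assume x: "x \<in> Pi UNIV (\<lambda>n. space (M n))" "c = ultra_rel \<uu> (\<lambda>n. space (M n)) `` {x}"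
    with c have "\<forall>\<^sub>F n in \<uu>. x n \<in> A n" by (simp add: internal_class)
    with A have "\<forall>\<^sub>F n in \<uu>. x n \<in> B n" by eventually_elim auto
    with x show ?thesis by (simp add: internal_class)
  qed
qed

lemma I_subD:
  assumes A: "A \<in> msets" and sub: "I A \<subseteq> I B"
  shows "\<forall>\<^sub>F n in \<uu>. A n \<subseteq> B n"
proof (rule ccontr)
  assume "\<not> (\<forall>\<^sub>F n in \<uu>. A n \<subseteq> B n)"
  then have e: "\<forall>\<^sub>F n in \<uu>. \<not> A n \<subseteq> B n" by (simp add: eventually_not_iff)
  have "\<exists>y. y \<in> space (M n) \<and> (\<not> A n \<subseteq> B n \<longrightarrow> y \<in> A n - B n)" for n
    using A prob_space.not_empty[OF prob, of n] sets.sets_into_space[of "A n" "M n"]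
    by (auto simp: msets_def) blast
  then obtain x where x: "\<And>n. x n \<in> space (M n)" "\<And>n. \<not> A n \<subseteq> B n \<longrightarrow> x n \<in> A n - B n"
    by metis
  have "\<forall>\<^sub>F n in \<uu>. x n \<in> A n - B n" using e by eventually_elim (use x in auto)
  then have "ultra_rel \<uu> (\<lambda>n. space (M n)) `` {x} \<in> I A - I B"
    unfolding I_Diff[symmetric] using x by (subst internal_class) auto
  then show False using sub by blast
qed

lemma m_mono_ev: "B \<in> msets \<Longrightarrow> \<forall>\<^sub>F n in \<uu>. A n \<subseteq> B n \<Longrightarrow> m A \<le> m B"
  by (rule tendsto_le[OF nb m_tendsto m_tendsto])
     (auto elim!: eventually_mono simp: msets_def intro: emeasure_mono)

lemma m_mono: "A \<in> msets \<Longrightarrow> B \<in> msets \<Longrightarrow> I A \<subseteq> I B \<Longrightarrow> m A \<le> m B"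
  by (rule m_mono_ev[OF _ I_subD])

lemma outer_def: "loeb_outer \<uu> M B = (INF A\<in>{A\<in>msets. B \<subseteq> I A}. m A)"
  by (simp add: loeb_outer_def msets_def m_def)

abbreviation "out \<equiv> loeb_outer \<uu> M"

lemma outer_I: "A \<in> msets \<Longrightarrow> out (I A) = m A"
  unfolding outer_def by (rule antisym) (auto intro!: INF_lower INF_greatest m_mono)

lemma outer_mono: "A \<subseteq> B \<Longrightarrow> out A \<le> out B"
  unfolding outer_def by (intro INF_superset_mono) auto

lemma msets_Un: "A \<in> msets \<Longrightarrow> B \<in> msets \<Longrightarrow> (\<lambda>n. A n \<union> B n) \<in> msets"
  and msets_Int: "A \<in> msets \<Longrightarrow> B \<in> msets \<Longrightarrow> (\<lambda>n. A n \<inter> B n) \<in> msets"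
  and msets_Diff: "A \<in> msets \<Longrightarrow> B \<in> msets \<Longrightarrow> (\<lambda>n. A n - B n) \<in> msets"
  and msets_empty: "(\<lambda>n. {}) \<in> msets" and msets_space: "(\<lambda>n. space (M n)) \<in> msets"
  by (auto simp: msets_def)

lemma m_space: "m (\<lambda>n. space (M n)) = 1"
  by (rule mI) (simp add: prob_space.emeasure_space_1[OF prob])

lemma m_empty: "m (\<lambda>n. {}) = 0"
  by (rule mI) simp

lemma m_le_1: "m A \<le> 1"
  by (rule tendsto_upperbound[OF m_tendsto _ nb])
     (simp add: prob_space.emeasure_le_1[OF prob])

lemma m_add: "A \<in> msets \<Longrightarrow> B \<in> msets \<Longrightarrow> m A = m (\<lambda>n. A n \<inter> B n) + m (\<lambda>n. A n - B n)"
proof (rule mI)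
  assume AB: "A \<in> msets" "B \<in> msets"
  have "((\<lambda>n. emeasure (M n) (A n \<inter> B n) + emeasure (M n) (A n - B n))
     \<longlongrightarrow> m (\<lambda>n. A n \<inter> B n) + m (\<lambda>n. A n - B n)) \<uu>"
    by (intro tendsto_add m_tendsto)
  also have "(\<lambda>n. emeasure (M n) (A n \<inter> B n) + emeasure (M n) (A n - B n)) = (\<lambda>n. emeasure (M n) (A n))"
  proof
    fix n
    have "emeasure (M n) (A n \<inter> B n) + emeasure (M n) (A n - B n) = emeasure (M n) ((A n \<inter> B n) \<union> (A n - B n))"
      using AB by (intro plus_emeasure) (auto simp: msets_def)
    also have "(A n \<inter> B n) \<union> (A n - B n) = A n" by blast
    finally show "emeasure (M n) (A n \<inter> B n) + emeasure (M n) (A n - B n) = emeasure (M n) (A n)" .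
  qed
  finally show "((\<lambda>n. emeasure (M n) (A n)) \<longlongrightarrow> m (\<lambda>n. A n \<inter> B n) + m (\<lambda>n. A n - B n)) \<uu>" .
qed

lemma saturation:
  assumes C: "\<And>k. C k \<in> msets" and inc: "\<And>k n. C k n \<subseteq> C (Suc k) n"
  shows "\<exists>B\<in>msets. (\<Union>k. I (C k)) \<subseteq> I B \<and> m B \<le> (SUP k. m (C k))"
proof -
  define s where "s = (SUP k. m (C k))"
  have "s \<le> 1" unfolding s_def by (rule SUP_least) (rule m_le_1)
  then have fin: "s < (Orderings.top::ennreal)" by (simp add: order_le_less_trans)
  define e where "e k = s + ennreal (1 / real (Suc k))" for k
  have s_less: "s < e k" for k
    unfolding e_def using fin by (cases s) (auto simp flip: ennreal_plus simp: ennreal_less_iff)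
  have e_anti: "e k \<le> e j" if "j \<le> k" for j k
    unfolding e_def using that by (intro add_left_mono ennreal_leI) (auto simp: field_simps)
  define good where "good k n \<longleftrightarrow> (\<forall>j\<le>k. emeasure (M n) (C j n) \<le> e j)" for k n
  define K where "K n = {k. k \<le> n \<and> good k n}" for n
  define B where "B n = (\<Union>k\<in>K n. C k n)" for n
  have finK: "finite (K n)" for n unfolding K_def by (rule finite_subset[of _ "{..n}"]) auto
  have Bm: "B \<in> msets"
    using C finK unfolding B_def msets_def by (auto intro!: sets.finite_UN)
  have Cinc: "C j n \<subseteq> C k n" if "j \<le> k" for j k n
    using that by (induction rule: dec_induct) (use inc in auto)
  have ev: "\<forall>\<^sub>F n in \<uu>. k \<in> K n" for k
  proof -
    have "\<forall>\<^sub>F n in \<uu>. \<forall>j\<in>{..k}. emeasure (M n) (C j n) \<le> e j"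
    proof (rule eventually_ball_finite, simp, rule)
      fix j
      have "m (C j) < e j"
        by (rule order_le_less_trans[OF _ s_less]) (auto simp: s_def intro: SUP_upper)
      with m_tendsto[of "C j"] have "\<forall>\<^sub>F n in \<uu>. emeasure (M n) (C j n) < e j"
        by (rule order_tendstoD)
      then show "\<forall>\<^sub>F n in \<uu>. emeasure (M n) (C j n) \<le> e j"
        by (rule eventually_mono) auto
    qed
    with nonprincipal_ultrafilter_eventually_ge[OF u, of k]
    show ?thesis by eventually_elim (auto simp: K_def good_def)
  qed
  have sub: "I (C k) \<subseteq> I B" for k
    by (rule I_mono) (use ev[of k] in \<open>auto elim!: eventually_mono simp: B_def\<close>)
  have mB: "m B \<le> e k" for k
  proof (rule tendsto_upperbound[OF m_tendsto _ nb])
    show "\<forall>\<^sub>F n in \<uu>. emeasure (M n) (B n) \<le> e k"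
      using ev[of k]
    proof eventually_elim
      case (elim n)
      define i where "i = Max (K n)"
      have i: "i \<in> K n" "k \<le> i" unfolding i_def using finK elim by (auto intro: Max_in)
      have "B n \<subseteq> C i n"
        unfolding B_def i_def using finK Cinc by (auto intro!: Max_ge) (meson Cinc Max_ge finK subsetD)
      then have "emeasure (M n) (B n) \<le> emeasure (M n) (C i n)"
        using C by (intro emeasure_mono) (auto simp: msets_def)
      also have "\<dots> \<le> e i" using i by (auto simp: K_def good_def)
      also have "\<dots> \<le> e k" using i by (intro e_anti)
      finally show ?case .
    qed
  qed
  have "e \<longlonglongrightarrow> s + ennreal 0"
    unfolding e_def
    by (intro tendsto_add tendsto_const tendsto_ennrealI LIMSEQ_Suc[OF lim_1_over_n])
  then have "m B \<le> s"
    using mB by (intro LIMSEQ_le_const[of e s]) auto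
  with Bm sub show ?thesis by (auto simp: s_def)
qed

lemma m_Un_le: "A \<in> msets \<Longrightarrow> B \<in> msets \<Longrightarrow> m (\<lambda>n. A n \<union> B n) \<le> m A + m B"
  by (rule tendsto_le[OF nb tendsto_add[OF m_tendsto m_tendsto] m_tendsto])
     (auto simp: msets_def intro!: always_eventually emeasure_subadditive)

lemma out_UN:
  fixes A :: "nat \<Rightarrow> (nat \<Rightarrow> 'x) set set"
  shows "out (\<Union>i. A i) \<le> (\<Sum>i. out (A i))"
proof -
  show ?thesis
  proof (rule ennreal_le_epsilon)
    fix \<epsilon> :: real assume fin: "(\<Sum>i. out (A i)) < (Orderings.top::ennreal)" and e: "0 < \<epsilon>"
    have "\<exists>D\<in>msets. A i \<subseteq> I D \<and> m D \<le> out (A i) + ennreal (\<epsilon> * (1/2)^Suc i)" for i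
    proof -
      have "out (A i) < (Orderings.top::ennreal)" using fin by (metis ennreal_suminf_lessD)
      then have "out (A i) < out (A i) + ennreal (\<epsilon> * (1/2)^Suc i)"
        using e by (cases "out (A i)") (auto simp flip: ennreal_plus simp: ennreal_less_iff)
      then obtain D where "D \<in> msets" "A i \<subseteq> I D" "m D < out (A i) + ennreal (\<epsilon> * (1/2)^Suc i)"
        unfolding outer_def[of "A i"] INF_less_iff by blast
      then show ?thesis by (auto intro: less_imp_le)
    qed
    then obtain D where D: "\<And>i. D i \<in> msets" "\<And>i. A i \<subseteq> I (D i)"
      "\<And>i. m (D i) \<le> out (A i) + ennreal (\<epsilon> * (1/2)^Suc i)"
      by metis
    define C where "C k n = (\<Union>i\<le>k. D i n)" for k n
    have C_Suc: "C (Suc k) = (\<lambda>n. C k n \<union> D (Suc k) n)" for k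
      by (rule ext) (auto simp: C_def atMost_Suc)
    have C0: "C 0 = D 0" by (rule ext) (auto simp: C_def)
    have C_inc: "C k n \<subseteq> C (Suc k) n" for k n unfolding C_def by (intro UN_mono) auto
    have Cm: "C k \<in> msets" for k
      by (induction k) (auto simp: C0 C_Suc D intro: msets_Un)
    have mC: "m (C k) \<le> (\<Sum>i\<le>k. m (D i))" for k
    proof (induction k)
      case (Suc k)
      have "m (C (Suc k)) \<le> m (C k) + m (D (Suc k))"
        unfolding C_Suc by (intro m_Un_le Cm D)
      also have "\<dots> \<le> (\<Sum>i\<le>k. m (D i)) + m (D (Suc k))" using Suc by (intro add_mono) auto
      finally show ?case by simp
    qed (simp add: C0)
    obtain B where B: "B \<in> msets" "(\<Union>k. I (C k)) \<subseteq> I B" "m B \<le> (SUP k. m (C k))"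
      using saturation[of C, OF Cm C_inc] by blast
    have "I (D k) \<subseteq> I (C k)" for k
      by (rule I_mono, rule always_eventually) (auto simp: C_def)
    then have "(\<Union>i. A i) \<subseteq> I B" using D B by blast
    then have "out (\<Union>i. A i) \<le> m B" using B unfolding outer_def by (intro INF_lower) auto
    also have "\<dots> \<le> (\<Sum>i. m (D i))"
    proof (rule order_trans[OF B(3)], rule SUP_least)
      fix k show "m (C k) \<le> (\<Sum>i. m (D i))"
        by (rule order_trans[OF mC]) (rule sum_le_suminf, auto)
    qed
    also have "\<dots> \<le> (\<Sum>i. out (A i) + ennreal (\<epsilon> * (1/2)^Suc i))"
      by (intro suminf_le D) auto
    also have "\<dots> = (\<Sum>i. out (A i)) + (\<Sum>i. ennreal (\<epsilon> * (1/2)^Suc i))"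
      by (intro suminf_add[symmetric]) auto
    also have "(\<Sum>i. ennreal (\<epsilon> * (1/2)^Suc i)) = ennreal \<epsilon>"
      using sums_mult[OF power_half_series, of \<epsilon>] e
      by (intro suminf_ennreal_eq) auto
    finally show "out (\<Union>i. A i) \<le> (\<Sum>i. out (A i)) + ennreal \<epsilon>" .
  qed
qed

lemma out_empty: "out {} = 0"
  using outer_I[OF msets_empty] by (simp add: I_empty m_empty)

lemma outer_subadd: "countably_subadditive (Pow X) out"
  by (auto simp: countably_subadditive_def intro: out_UN)

lemma oms: "outer_measure_space (Pow X) out"
  by (auto simp: outer_measure_space_def positive_def increasing_def outer_subadd out_empty
      intro: outer_mono)

lemma out_Un: "out (A \<union> B) \<le> out A + out B"
  using out_UN[of "binaryset A B"]
  unfolding UN_binaryset_eq suminf_binaryset_eq[of out, OF out_empty] .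

definition "\<Lambda> = lambda_system X (Pow X) out"

lemma Lambda: "measure_space X \<Lambda> out"
  unfolding \<Lambda>_def by (rule sigma_algebra.caratheodory_lemma[OF sigma_algebra_Pow oms])

lemma LambdaI:
  assumes "l \<subseteq> X" "\<And>x. x \<subseteq> X \<Longrightarrow> out (x \<inter> l) + out (x - l) \<le> out x"
  shows "l \<in> \<Lambda>"
proof -
  have "out (l \<inter> x) + out ((X - l) \<inter> x) = out x" if x: "x \<subseteq> X" for x
  proof -
    have "out x = out ((x \<inter> l) \<union> (x - l))" by (rule arg_cong[of _ _ out]) blast
    also have "\<dots> \<le> out (x \<inter> l) + out (x - l)"
      by (rule out_Un)
    finally have "out (x \<inter> l) + out (x - l) = out x"
      using assms(2)[OF x] by (intro antisym)
    moreover have "out (l \<inter> x) = out (x \<inter> l)" by (rule arg_cong[of _ _ out]) blast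
    moreover have "out ((X - l) \<inter> x) = out (x - l)" by (rule arg_cong[of _ _ out]) (use x in blast)
    ultimately show ?thesis by (simp only:)
  qed
  then show ?thesis using assms(1) unfolding \<Lambda>_def lambda_system_def by auto
qed

lemma I_Lambda: "A \<in> msets \<Longrightarrow> I A \<in> \<Lambda>"
proof (rule LambdaI[OF I_sub])
  fix x assume A: "A \<in> msets" and "x \<subseteq> X"
  show "out (x \<inter> I A) + out (x - I A) \<le> out x"
    unfolding outer_def[of x]
  proof (rule INF_greatest, clarify)
    fix B assume B: "B \<in> msets" "x \<subseteq> I B"
    have "out (x \<inter> I A) + out (x - I A) \<le> out (I (\<lambda>n. B n \<inter> A n)) + out (I (\<lambda>n. B n - A n))"
      using B by (intro add_mono outer_mono) (auto simp: I_Int I_Diff)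
    also have "\<dots> = m B" using A B by (simp add: outer_I msets_Int msets_Diff m_add[of B A])
    finally show "out (x \<inter> I A) + out (x - I A) \<le> m B" .
  qed
qed

lemma null_Lambda: "N \<subseteq> X \<Longrightarrow> out N = 0 \<Longrightarrow> N \<in> \<Lambda>"
proof (rule LambdaI, assumption)
  fix x assume "out N = 0"
  then have "out (x \<inter> N) = 0" using outer_mono[of "x \<inter> N" N] by auto
  then show "out (x \<inter> N) + out (x - N) \<le> out x" by (auto intro: outer_mono)
qed

lemma loeb_sets_eq: "loeb_sets \<uu> M = {B. B \<subseteq> X \<and> (\<exists>A\<in>msets. out (sym_diff B (I A)) = 0)}"
  by (auto simp: loeb_sets_def msets_def)

lemma loeb_sub: "loeb_sets \<uu> M \<subseteq> \<Lambda>"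
proof
  fix B assume "B \<in> loeb_sets \<uu> M"
  then obtain A where B: "B \<subseteq> X" and A: "A \<in> msets" and 0: "out (sym_diff B (I A)) = 0"
    by (auto simp: loeb_sets_eq)
  interpret L: sigma_algebra X \<Lambda> using Lambda by (simp add: measure_space_def)
  have "out (B - I A) = 0" "out (I A - B) = 0"
    using outer_mono[of "B - I A" "sym_diff B (I A)"] outer_mono[of "I A - B" "sym_diff B (I A)"] 0
    by auto
  then have "B - I A \<in> \<Lambda>" "I A - B \<in> \<Lambda>"
    using B I_sub by (auto intro!: null_Lambda)
  then have "(I A - (I A - B)) \<union> (B - I A) \<in> \<Lambda>"
    using I_Lambda[OF A] by auto
  also have "(I A - (I A - B)) \<union> (B - I A) = B" by blast
  finally show "B \<in> \<Lambda>" .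
qed

lemma null_UN: 
  assumes "\<And>i::nat. out (N i) = 0"
  shows "out (\<Union>i. N i) = 0"
proof -
  have "out (\<Union>i. N i) \<le> (\<Sum>i. out (N i))"
    by (rule out_UN)
  then show ?thesis using assms by simp
qed

lemma null_sub: "A \<subseteq> B \<Longrightarrow> out B = 0 \<Longrightarrow> out A = 0"
  using outer_mono[of A B] by auto

lemma sigma_loeb: "sigma_algebra X (loeb_sets \<uu> M)"
  unfolding sigma_algebra_iff2
proof (intro conjI ballI allI impI)
  show "loeb_sets \<uu> M \<subseteq> Pow X" by (auto simp: loeb_sets_eq)
  show "{} \<in> loeb_sets \<uu> M"
    by (auto simp: loeb_sets_eq I_empty out_empty intro!: bexI[of _ "\<lambda>n. {}"] msets_empty)
next
  fix B assume "B \<in> loeb_sets \<uu> M"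
  then obtain A where B: "B \<subseteq> X" and A: "A \<in> msets" and 0: "out (sym_diff B (I A)) = 0"
    by (auto simp: loeb_sets_eq)
  have "sym_diff (X - B) (I (\<lambda>n. space (M n) - A n)) \<subseteq> sym_diff B (I A)"
    unfolding I_Diff I_space using B I_sub by blast
  then have "out (sym_diff (X - B) (I (\<lambda>n. space (M n) - A n))) = 0" using 0 by (rule null_sub)
  then show "X - B \<in> loeb_sets \<uu> M"
    using msets_Diff[OF msets_space A] by (auto simp: loeb_sets_eq)
next
  fix B :: "nat \<Rightarrow> _" assume "range B \<subseteq> loeb_sets \<uu> M"
  then have "\<forall>i. B i \<subseteq> X \<and> (\<exists>A\<in>msets. out (sym_diff (B i) (I A)) = 0)"
    by (auto simp: loeb_sets_eq)
  then obtain D where B: "\<And>i. B i \<subseteq> X" and D: "\<And>i. D i \<in> msets"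
    and 0: "\<And>i. out (sym_diff (B i) (I (D i))) = 0" by metis
  define C where "C k n = (\<Union>i\<le>k. D i n)" for k n
  have C_Suc: "C (Suc k) = (\<lambda>n. C k n \<union> D (Suc k) n)" for k
    by (rule ext) (auto simp: C_def atMost_Suc)
  have C0: "C 0 = D 0" by (rule ext) (auto simp: C_def)
  have C_inc: "C k n \<subseteq> C (Suc k) n" for k n unfolding C_def by (intro UN_mono) auto
  have Cm: "C k \<in> msets" for k
    by (induction k) (auto simp: C0 C_Suc D intro: msets_Un)
  have IC: "I (C k) = (\<Union>i\<le>k. I (D i))" for k
    by (induction k) (auto simp: C0 C_Suc I_Un atMost_Suc)
  obtain E where E: "E \<in> msets" "(\<Union>k. I (C k)) \<subseteq> I E" "m E \<le> (SUP k. m (C k))"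
    using saturation[of C, OF Cm C_inc] by blast
  have UC: "(\<Union>k. I (C k)) = (\<Union>k. I (D k))" by (auto simp: IC)
  have diff0: "out (I E - (\<Union>k. I (D k))) = 0"
  proof -
    interpret L: sigma_algebra X \<Lambda> using Lambda by (simp add: measure_space_def)
    have U: "(\<Union>k. I (D k)) \<in> \<Lambda>" using I_Lambda D by auto
    have sub: "(\<Union>k. I (D k)) \<subseteq> I E" using E UC by auto
    have "out (\<Union>k. I (D k)) + out (I E - (\<Union>k. I (D k))) = out (I E)"
    proof -
      have "out ((\<Union>k. I (D k)) \<inter> I E) + out ((X - (\<Union>k. I (D k))) \<inter> I E) = out (I E)"
        using U I_sub[of E] unfolding \<Lambda>_def lambda_system_def by blast
      moreover have "(\<Union>k. I (D k)) \<inter> I E = (\<Union>k. I (D k))" using sub by blast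
      moreover have "(X - (\<Union>k. I (D k))) \<inter> I E = I E - (\<Union>k. I (D k))" using I_sub by blast
      ultimately show ?thesis by simp
    qed
    moreover have "out (I E) \<le> out (\<Union>k. I (D k))"
      unfolding outer_I[OF E(1)]
    proof (rule order_trans[OF E(3)], rule SUP_least)
      fix k show "m (C k) \<le> out (\<Union>k. I (D k))"
        unfolding outer_I[OF Cm, symmetric] by (rule outer_mono) (use UC in auto)
    qed
    moreover have "out (\<Union>k. I (D k)) \<le> 1"
      using outer_mono[OF sub] outer_I[OF E(1)] m_le_1[of E] by auto
    then have "out (\<Union>k. I (D k)) \<noteq> (Orderings.top::ennreal)" by (metis ennreal_one_neq_top top.extremum_unique)
    ultimately have "out (\<Union>k. I (D k)) + out (I E - (\<Union>k. I (D k))) \<le> out (\<Union>k. I (D k)) + 0"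
      by simp
    with \<open>out (\<Union>k. I (D k)) \<noteq> (Orderings.top::ennreal)\<close> show ?thesis
      unfolding ennreal_add_left_cancel_le by (auto simp: infinity_ennreal_def)
  qed
  have aux: "sym_diff (\<Union>i. P i) F \<subseteq> (\<Union>i. sym_diff (P i) (Q i)) \<union> (F - (\<Union>k. Q k))"
    if "(\<Union>k. Q k) \<subseteq> F" for P Q :: "nat \<Rightarrow> (nat \<Rightarrow> 'x) set set" and F
    using that by auto
  have "sym_diff (\<Union>i. B i) (I E) \<subseteq> (\<Union>i. sym_diff (B i) (I (D i))) \<union> (I E - (\<Union>k. I (D k)))"
    by (rule aux) (use E(2) in \<open>simp only: UC\<close>)
  moreover have "out ((\<Union>i. sym_diff (B i) (I (D i))) \<union> (I E - (\<Union>k. I (D k)))) = 0"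
  proof -
    have "out ((\<Union>i. sym_diff (B i) (I (D i))) \<union> (I E - (\<Union>k. I (D k))))
       \<le> out (\<Union>i. sym_diff (B i) (I (D i))) + out (I E - (\<Union>k. I (D k)))"
      by (rule out_Un)
    also have "\<dots> = 0" by (simp add: null_UN diff0 0)
    finally show ?thesis by simp
  qed
  ultimately have "out (sym_diff (\<Union>i. B i) (I E)) = 0" by (rule null_sub)
  with B E show "(\<Union>i. B i) \<in> loeb_sets \<uu> M" by (auto simp: loeb_sets_eq)
qed

lemma measure_space_loeb: "measure_space X (loeb_sets \<uu> M) out"
  by (rule measure_down[OF Lambda sigma_loeb loeb_sub])

lemma space_loeb: "space (loeb_measure \<uu> M) = X"
  using sigma_loeb unfolding loeb_measure_def
  by (simp add: space_measure_of_conv)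

lemma sets_loeb: "sets (loeb_measure \<uu> M) = loeb_sets \<uu> M"
  unfolding loeb_measure_def
  by (rule sigma_algebra.sets_measure_of_eq[OF sigma_loeb])

lemma emeasure_loeb: "B \<in> loeb_sets \<uu> M \<Longrightarrow> emeasure (loeb_measure \<uu> M) B = out B"
  using measure_space_loeb sigma_loeb unfolding loeb_measure_def measure_space_def
  by (intro emeasure_measure_of_sigma) auto

lemma internal_loeb: "A \<in> msets \<Longrightarrow> I A \<in> loeb_sets \<uu> M"
  using I_sub by (auto simp: loeb_sets_eq out_empty intro!: bexI[of _ A])

lemma emeasure_loeb_internal: "A \<in> msets \<Longrightarrow> emeasure (loeb_measure \<uu> M) (I A) = m A"
  by (simp add: emeasure_loeb internal_loeb outer_I)

lemma prob_space_loeb: "prob_space (loeb_measure \<uu> M)"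
  using emeasure_loeb_internal[OF msets_space]
  by (intro prob_spaceI) (simp add: I_space m_space space_loeb)

end

lemma prob_space_coset_measure:
  assumes "group G" "finite (lcosets\<^bsub>G\<^esub> K)"
  shows "prob_space (coset_measure G K)"
proof -
  have "lcosets\<^bsub>G\<^esub> K \<noteq> {}"
    using monoid.one_closed[OF group.is_monoid[OF assms(1)]] by (auto simp: LCOSETS_def)
  then show ?thesis
    unfolding coset_measure_def by (rule prob_space_uniform_count_measure[OF assms(2)])
qed

theorem emeasure_loeb_coset_measure:
  assumes "group G" "farber_sequence G H" "nonprincipal_ultrafilter \<uu>"
    and A: "\<And>n. A n \<subseteq> lcosets\<^bsub>G\<^esub> (H n)"
  shows "((\<lambda>n. ennreal (real (card (A n)) / real (card (lcosets\<^bsub>G\<^esub> (H n))))) \<longlongrightarrow>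
      emeasure (loeb_measure \<uu> (\<lambda>n. coset_measure G (H n)))
        (internal_set \<uu> (\<lambda>n. lcosets\<^bsub>G\<^esub> (H n)) A)) \<uu>"
proof -
  have fin: "finite (lcosets\<^bsub>G\<^esub> (H n))" for n
    using assms(2) by (simp add: farber_sequence_def)
  interpret loeb_space \<uu> "\<lambda>n. coset_measure G (H n)"
    by (intro loeb_space.intro assms(3) prob_space_coset_measure[OF assms(1) fin])
  have "A \<in> msets"
    unfolding msets_def using A by (simp add: coset_measure_def sets_uniform_count_measure)
  have em: "emeasure (coset_measure G (H n)) (A n)
      = ennreal (real (card (A n)) / real (card (lcosets\<^bsub>G\<^esub> (H n))))" for n
    unfolding coset_measure_def by (rule emeasure_uniform_count_measure[OF fin A])
  have sp: "space (coset_measure G (H n)) = lcosets\<^bsub>G\<^esub> (H n)" for n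
    by (simp add: coset_measure_def space_uniform_count_measure)
  show ?thesis
    using m_tendsto[of A] unfolding emeasure_loeb_internal[OF \<open>A \<in> msets\<close>, symmetric] em sp .
qed

end

theory Submission
  imports Defs
begin

text \<open>
  For a finite action, all costs are infima of \<open>card U / card X\<close> over finite sets \<open>U\<close> of arrows.
  Along a nested sequence arrows lift through the projections of coset spaces, so the Lipschitz
  costs \<open>C_L(a_n)\<close> decrease in \<open>n\<close>, limits along the sequence and along the ultrafilter are infima,
  and the infima over \<open>L\<close> and \<open>n\<close> commute. A graph is turned into a set of arrows by choosing short
  group elements along its edges; this is ambiguous only at points with short nontrivial stabilizing
  elements, whose proportion tends to \<open>0\<close> by the Farber condition. The ultraproduct factors onto each
  \<open>a_n\<close>, so its cost is at most \<open>C(a_n)\<close>. Conversely, the slices of a generating graphing of the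
  ultraproduct are internal up to null sets, and words of bounded length in finitely many slices
  already give the generators outside a small internal set; reading these internal sets at
  a single index \<open>n\<close> gives a set of arrows of almost the same cost for \<open>a_n\<close>.
\<close>

section \<open>Words in a set of arrows\<close>

text \<open>The obstacle is that a generating graphing of the ultraproduct comes with no uniform
  word length: at almost every point each generator is a word in it, but the length depends on the
  point, whereas a Lipschitz constant is uniform. At one finite level there is no such gap, since
  only finitely many generator arrows have to be expressed. In the ultraproduct both the letters and
  the length are cut off at K; where this fails, all generators are added, at a price of at most
  card S times the measure of that set, which tends to 0 as K grows. The same repair handles the
  ambiguous points of the graph comparison. The index n at which internal sets are read requires no
  choice: the common value is an infimum over both L and n, so the admissible set found at each n,
  with constant max K 1, already bounds it. Then comes the limit along the ultrafilter, and K grows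
  last. Costs are computed on arrows (g, x), not on pairs of points: a word remembers its group
  element, which is what lets it lift through factor maps and be measured by word length in the
  group.\<close>

definition sym_arrows ::
  "('g, 'b) monoid_scheme \<Rightarrow> ('g \<Rightarrow> 'x \<Rightarrow> 'x) \<Rightarrow> ('g \<times> 'x) set \<Rightarrow> ('g \<times> 'x) set" where
  "sym_arrows G a U = U \<union> {(inv\<^bsub>G\<^esub> g, a g x) |g x. (g, x) \<in> U}"

text \<open>New letters are put on the left, at the point \<open>a g x\<close> reached so far,
  matching the right fold in \<open>bounded_products\<close>. Shorter words are kept at each stage,
  so the index bounds the length instead of prescribing it.\<close>

primrec words ::
  "('g, 'b) monoid_scheme \<Rightarrow> 'x set \<Rightarrow> ('g \<Rightarrow> 'x \<Rightarrow> 'x) \<Rightarrow> ('g \<times> 'x) set \<Rightarrow> nat \<Rightarrow> ('g \<times> 'x) set" where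
  "words G X a U 0 = {\<one>\<^bsub>G\<^esub>} \<times> X"
| "words G X a U (Suc k) = words G X a U k \<union>
    {(d \<otimes>\<^bsub>G\<^esub> g, x) |d g x. (g, x) \<in> words G X a U k \<and> (d, a g x) \<in> sym_arrows G a U}"

primrec word_ball :: "('g, 'b) monoid_scheme \<Rightarrow> 'g set \<Rightarrow> nat \<Rightarrow> 'g set" where
  "word_ball G S 0 = {\<one>\<^bsub>G\<^esub>}"
| "word_ball G S (Suc k) = word_ball G S k \<union>
    {d \<otimes>\<^bsub>G\<^esub> g |d g. d \<in> S \<union> (\<lambda>s. inv\<^bsub>G\<^esub> s) ` S \<and> g \<in> word_ball G S k}"

lemma sym_arrows_mono: "U \<subseteq> U' \<Longrightarrow> sym_arrows G a U \<subseteq> sym_arrows G a U'"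
  by (auto simp: sym_arrows_def)

lemma words_mono:
  assumes "U \<subseteq> U'" "k \<le> k'"
  shows "words G X a U k \<subseteq> words G X a U' k'"
proof -
  have "words G X a U k \<subseteq> words G X a U' k"
    by (induction k) (use sym_arrows_mono[OF assms(1), of G a] in auto, blast)
  also have "\<dots> \<subseteq> words G X a U' k'"
    using assms(2) by (induction rule: dec_induct) auto
  finally show ?thesis .
qed

lemma word_ball_mono: "k \<le> k' \<Longrightarrow> word_ball G S k \<subseteq> word_ball G S k'"
  by (induction rule: dec_induct) auto

lemma finite_word_ball:
  assumes "finite S"
  shows "finite (word_ball G S k)"
proof (induction k)
  case (Suc k)
  have "{d \<otimes>\<^bsub>G\<^esub> g |d g. d \<in> S \<union> (\<lambda>s. inv\<^bsub>G\<^esub> s) ` S \<and> g \<in> word_ball G S k}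
      = (\<lambda>(d, g). d \<otimes>\<^bsub>G\<^esub> g) ` ((S \<union> (\<lambda>s. inv\<^bsub>G\<^esub> s) ` S) \<times> word_ball G S k)" by auto
  with Suc assms show ?case by simp
qed simp

section \<open>Word balls in a group\<close>

context group begin

lemma word_ball_closed:
  assumes "S \<subseteq> carrier G"
  shows "word_ball G S k \<subseteq> carrier G"
  by (induction k) (use assms in auto)

lemma word_ball_mult:
  assumes S: "S \<subseteq> carrier G" and "g \<in> word_ball G S j" "h \<in> word_ball G S k"
  shows "g \<otimes> h \<in> word_ball G S (j + k)"
  using assms(2)
proof (induction j arbitrary: g)
  case 0
  then show ?case using assms word_ball_closed[OF S, of k] by auto
next
  case (Suc j)
  show ?case
  proof (cases "g \<in> word_ball G S j")
    case True
    with Suc show ?thesis by auto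
  next
    case False
    then obtain d g' where d: "d \<in> S \<union> (\<lambda>s. inv s) ` S" "g' \<in> word_ball G S j" "g = d \<otimes> g'"
      using Suc.prems by auto
    then have "d \<in> carrier G" "g' \<in> carrier G" "h \<in> carrier G"
      using assms word_ball_closed[OF S] by auto
    then have "g \<otimes> h = d \<otimes> (g' \<otimes> h)" using d by (simp add: m_assoc)
    with d Suc.IH[OF d(2)] show ?thesis by auto
  qed
qed

lemma generators_in_word_ball:
  assumes S: "S \<subseteq> carrier G" and "d \<in> S \<union> (\<lambda>s. inv s) ` S"
  shows "d \<in> word_ball G S (Suc 0)"
proof -
  have "d \<in> carrier G" using assms by auto
  then have "d = d \<otimes> \<one>" by simp
  with assms(2) show ?thesis by auto
qed

lemma word_ball_inv:
  assumes S: "S \<subseteq> carrier G" and "g \<in> word_ball G S k"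
  shows "inv g \<in> word_ball G S k"
  using assms(2)
proof (induction k arbitrary: g)
  case (Suc k)
  show ?case
  proof (cases "g \<in> word_ball G S k")
    case False
    then obtain d h where d: "d \<in> S \<union> (\<lambda>s. inv s) ` S" "h \<in> word_ball G S k" "g = d \<otimes> h"
      using Suc.prems by auto
    have c: "d \<in> carrier G" "h \<in> carrier G" using d S word_ball_closed[OF S] by auto
    have "inv d \<in> S \<union> (\<lambda>s. inv s) ` S" using d(1) S by auto
    then have "inv h \<otimes> inv d \<in> word_ball G S (k + Suc 0)"
      using Suc.IH[OF d(2)] generators_in_word_ball[OF S] by (intro word_ball_mult[OF S]) auto
    then show ?thesis using d c by (simp add: inv_mult_group del: word_ball.simps)
  qed (use Suc in auto)
qed auto

lemma generate_in_word_ball: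
  assumes S: "S \<subseteq> carrier G" and "g \<in> generate G S"
  shows "\<exists>k. g \<in> word_ball G S k"
  using assms(2)
proof induction
  case one
  show ?case by (rule exI[of _ 0]) simp
next
  case (incl h)
  then show ?case using generators_in_word_ball[OF S, of h] by blast
next
  case (inv h)
  then show ?case using generators_in_word_ball[OF S, of "inv h"] by blast
next
  case (eng g h)
  then show ?case using word_ball_mult[OF S] by blast
qed

end

section \<open>Arrows and words for a group action\<close>

locale set_action = group G for G :: "('g, 'b) monoid_scheme" (structure) +
  fixes X :: "'x set" and a :: "'g \<Rightarrow> 'x \<Rightarrow> 'x"
  assumes act_closed: "g \<in> carrier G \<Longrightarrow> x \<in> X \<Longrightarrow> a g x \<in> X"
    and act_one: "x \<in> X \<Longrightarrow> a \<one> x = x"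
    and act_mult: "g \<in> carrier G \<Longrightarrow> h \<in> carrier G \<Longrightarrow> x \<in> X \<Longrightarrow> a (g \<otimes> h) x = a g (a h x)"
begin

lemma act_inv: "g \<in> carrier G \<Longrightarrow> x \<in> X \<Longrightarrow> a (inv g) (a g x) = x"
  and act_inv': "g \<in> carrier G \<Longrightarrow> x \<in> X \<Longrightarrow> a g (a (inv g) x) = x"
  by (simp_all flip: act_mult add: act_one)

lemma act_inj:
  assumes "g \<in> carrier G" "x \<in> X" "y \<in> X" "a g x = a g y"
  shows "x = y"
proof -
  have "x = a (inv g) (a g x)" using assms(1,2) by (simp add: act_inv)
  also have "\<dots> = y" using assms(1,3) by (simp add: assms(4) act_inv)
  finally show ?thesis .
qed

text \<open>Reversing an arrow twice gives it back, so the existential in \<open>sym_arrows\<close>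
  becomes a test on the reversed arrow. The test involves the target of the letter, which is why the
  transfer arguments for words check both endpoints of every letter.\<close>

lemma sym_arrows_iff:
  assumes "U \<subseteq> carrier G \<times> X"
  shows "(d, y) \<in> sym_arrows G a U \<longleftrightarrow>
    (d, y) \<in> U \<or> (d \<in> carrier G \<and> y \<in> X \<and> (inv d, a d y) \<in> U)"
proof
  assume "(d, y) \<in> sym_arrows G a U"
  then consider "(d, y) \<in> U" | g x where "(g, x) \<in> U" "d = inv g" "y = a g x"
    unfolding sym_arrows_def by auto
  then show "(d, y) \<in> U \<or> (d \<in> carrier G \<and> y \<in> X \<and> (inv d, a d y) \<in> U)"
  proof cases
    case 2
    then have "g \<in> carrier G" "x \<in> X" using assms by auto
    with 2 show ?thesis by (auto simp: act_inv act_closed)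
  qed simp
next
  assume "(d, y) \<in> U \<or> (d \<in> carrier G \<and> y \<in> X \<and> (inv d, a d y) \<in> U)"
  then show "(d, y) \<in> sym_arrows G a U"
  proof
    assume d: "d \<in> carrier G \<and> y \<in> X \<and> (inv d, a d y) \<in> U"
    then have "(d, y) = (inv (inv d), a (inv d) (a d y))" by (simp add: act_inv)
    with d show ?thesis unfolding sym_arrows_def by blast
  qed (simp add: sym_arrows_def)
qed

lemma sym_arrows_closed:
  assumes "U \<subseteq> carrier G \<times> X"
  shows "sym_arrows G a U \<subseteq> carrier G \<times> X"
  using assms by (auto simp: sym_arrows_iff)

lemma words_closed:
  assumes "U \<subseteq> carrier G \<times> X"
  shows "words G X a U k \<subseteq> carrier G \<times> X"
proof (induction k)
  case (Suc k)
  then show ?case using sym_arrows_closed[OF assms] by auto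
qed auto

lemma sym_arrows_words:
  assumes U: "U \<subseteq> carrier G \<times> X"
  shows "sym_arrows G a U \<subseteq> words G X a U (Suc 0)"
proof
  fix e assume "e \<in> sym_arrows G a U"
  moreover obtain d x where e: "e = (d, x)" by (cases e)
  ultimately have d: "(d, x) \<in> sym_arrows G a U" "d \<in> carrier G" "x \<in> X"
    using sym_arrows_closed[OF U] by auto
  have "(d, x) = (d \<otimes> \<one>, x)" "(d, a \<one> x) \<in> sym_arrows G a U"
    using d by (simp_all add: act_one)
  with d(3) show "e \<in> words G X a U (Suc 0)" unfolding e by auto
qed

lemma subset_words:
  assumes "U \<subseteq> carrier G \<times> X" "1 \<le> k"
  shows "U \<subseteq> words G X a U k"
proof -
  have "U \<subseteq> sym_arrows G a U" by (simp add: sym_arrows_def)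
  also have "\<dots> \<subseteq> words G X a U (Suc 0)" by (rule sym_arrows_words[OF assms(1)])
  also have "\<dots> \<subseteq> words G X a U k" by (rule words_mono) (use assms(2) in auto)
  finally show ?thesis .
qed

lemma words_mult:
  assumes U: "U \<subseteq> carrier G \<times> X" and "(h, x) \<in> words G X a U k"
    and "(g, a h x) \<in> words G X a U j"
  shows "(g \<otimes> h, x) \<in> words G X a U (j + k)"
  using assms(3)
proof (induction j arbitrary: g)
  case 0
  then show ?case using assms words_closed[OF U, of k] by auto
next
  case (Suc j)
  have hx: "h \<in> carrier G" "x \<in> X" using assms words_closed[OF U] by auto
  show ?case
  proof (cases "(g, a h x) \<in> words G X a U j")
    case False
    then obtain d g' where d: "(g', a h x) \<in> words G X a U j"
      "(d, a g' (a h x)) \<in> sym_arrows G a U" "g = d \<otimes> g'"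
      using Suc.prems by auto
    have c: "d \<in> carrier G" "g' \<in> carrier G"
      using d words_closed[OF U] sym_arrows_closed[OF U] by auto
    have "(d, a (g' \<otimes> h) x) \<in> sym_arrows G a U" "g \<otimes> h = d \<otimes> (g' \<otimes> h)"
      using c hx d by (simp_all add: act_mult m_assoc)
    with Suc.IH[OF d(1)] show ?thesis by auto
  qed (use Suc in auto)
qed

lemma sym_arrows_inv:
  assumes U: "U \<subseteq> carrier G \<times> X" and "(d, y) \<in> sym_arrows G a U"
  shows "(inv d, a d y) \<in> sym_arrows G a U"
proof -
  have "d \<in> carrier G" "y \<in> X" using assms sym_arrows_closed[OF U] by auto
  then show ?thesis using assms by (auto simp: sym_arrows_iff act_inv act_closed)
qed

lemma words_inv:
  assumes U: "U \<subseteq> carrier G \<times> X" and "(g, x) \<in> words G X a U k"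
  shows "(inv g, a g x) \<in> words G X a U k"
  using assms(2)
proof (induction k arbitrary: g)
  case 0
  then show ?case by (auto simp: act_one)
next
  case (Suc k)
  show ?case
  proof (cases "(g, x) \<in> words G X a U k")
    case False
    then obtain d h where d: "(h, x) \<in> words G X a U k" "(d, a h x) \<in> sym_arrows G a U" "g = d \<otimes> h"
      using Suc.prems by auto
    have c: "d \<in> carrier G" "h \<in> carrier G" "x \<in> X"
      using d words_closed[OF U] sym_arrows_closed[OF U] by auto
    have "(inv d, a d (a h x)) \<in> words G X a U (Suc 0)"
      using sym_arrows_inv[OF U d(2)] sym_arrows_words[OF U] by blast
    moreover have "(inv h, a (inv d) (a d (a h x))) \<in> words G X a U k"
      using Suc.IH[OF d(1)] c by (simp add: act_inv act_closed)
    \<comment> \<open>In the reversed word the inverse of the last letter comes first, hence on the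
      right; the recursion adds letters on the left, so \<open>words_mult\<close> is used
      instead.\<close>
    ultimately have "(inv h \<otimes> inv d, a d (a h x)) \<in> words G X a U (k + Suc 0)"
      by (rule words_mult[OF U])
    then show ?thesis using c d by (simp add: inv_mult_group act_mult del: words.simps)
  qed (use Suc in auto)
qed

text \<open>The letters of \<open>S \<times> X\<close> are available at every point, so the base
  point imposes no condition and words split off as a product. Being Lipschitz over the generators
  thus becomes a bound on word length in the group.\<close>

lemma words_generators:
  assumes S: "S \<subseteq> carrier G"
  shows "words G X a (S \<times> X) k = word_ball G S k \<times> X"
proof (induction k)
  case (Suc k)
  have U: "S \<times> X \<subseteq> carrier G \<times> X" using S by auto
  define T where "T = S \<union> (\<lambda>s. inv s) ` S"
  have iff: "(d, y) \<in> sym_arrows G a (S \<times> X) \<longleftrightarrow> d \<in> T \<and> y \<in> X" for d y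
  proof -
    have "d \<in> carrier G \<and> inv d \<in> S \<longleftrightarrow> d \<in> (\<lambda>s. inv s) ` S"
      using S by (auto simp: image_iff) (metis inv_inv subset_iff)
    then show ?thesis using S unfolding T_def by (auto simp: sym_arrows_iff[OF U] act_closed)
  qed
  have "a g x \<in> X" if "g \<in> word_ball G S k" "x \<in> X" for g x
    using that word_ball_closed[OF S] act_closed by blast
  then show ?case using Suc by (auto simp: iff simp flip: T_def)
qed auto

lemma words_word_ball:
  assumes S: "S \<subseteq> carrier G" and U: "U \<subseteq> word_ball G S l \<times> X"
  shows "words G X a U k \<subseteq> word_ball G S (l * k) \<times> X"
proof (induction k)
  case (Suc k)
  have U': "U \<subseteq> carrier G \<times> X" using U word_ball_closed[OF S] by blast
  have "d \<in> word_ball G S l" if "(d, y) \<in> sym_arrows G a U" for d y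
    using that U word_ball_inv[OF S] unfolding sym_arrows_def by auto
  then have "d \<otimes> g \<in> word_ball G S (l + l * k)" if "(d, a g x) \<in> sym_arrows G a U" "(g, x) \<in> words G X a U k" for d g x
    using that Suc by (intro word_ball_mult[OF S]) auto
  moreover have "word_ball G S (l * k) \<subseteq> word_ball G S (l + l * k)" by (rule word_ball_mono) simp
  ultimately show ?case using Suc by auto
qed auto

text \<open>A single word has finitely many letters, and each lies in some word ball. The same K
  bounds letters and length, so one parameter governs the truncation.\<close>

lemma words_truncate:
  assumes S: "S \<subseteq> carrier G" "generate G S = carrier G" and U: "U \<subseteq> carrier G \<times> X"
    and "(g, x) \<in> words G X a U k"
  shows "\<exists>K. (g, x) \<in> words G X a (U \<inter> word_ball G S K \<times> X) K"
  using assms(4)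
proof (induction k arbitrary: g)
  case 0
  then show ?case by (auto intro!: exI[of _ 0])
next
  case (Suc k)
  let ?U = "\<lambda>K. U \<inter> word_ball G S K \<times> X"
  have U': "?U K \<subseteq> carrier G \<times> X" for K using U by auto
  show ?case
  proof (cases "(g, x) \<in> words G X a U k")
    case False
    then obtain d h where d: "(h, x) \<in> words G X a U k" "(d, a h x) \<in> sym_arrows G a U" "g = d \<otimes> h"
      using Suc.prems by auto
    obtain K where K: "(h, x) \<in> words G X a (?U K) K" using Suc.IH[OF d(1)] by blast
    have c: "d \<in> carrier G" using d sym_arrows_closed[OF U] by auto
    then obtain l where l: "d \<in> word_ball G S l" using generate_in_word_ball[OF S(1), of d] S by auto
    then have "(d, a h x) \<in> sym_arrows G a (?U l)"
      using d(2) word_ball_inv[OF S(1) l]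
      by (auto simp: sym_arrows_iff[OF U] sym_arrows_iff[OF U'] act_closed dest: subsetD[OF U])
    \<comment> \<open>The successor makes room for the new letter in the word; the maximum makes the
      ball contain the old letters and \<open>d\<close>.\<close>
    moreover define K' where "K' = Suc (max K l)"
    have "word_ball G S l \<subseteq> word_ball G S K'" "word_ball G S K \<subseteq> word_ball G S K'"
      unfolding K'_def by (rule word_ball_mono, simp)+
    then have sub: "?U l \<subseteq> ?U K'" "?U K \<subseteq> ?U K'" by auto
    ultimately have "(d, a h x) \<in> sym_arrows G a (?U K')" using sym_arrows_mono by blast
    moreover have "(h, x) \<in> words G X a (?U K') (max K l)"
      using K words_mono[OF sub(2), of K "max K l" G X a] by auto
    ultimately have "(g, x) \<in> words G X a (?U K') (Suc (max K l))"
      using d(3) by auto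
    then show ?thesis unfolding K'_def by blast
  qed (use Suc in auto)
qed

text \<open>This allows the slices of a graphing to be altered on an invariant null set \<open>N\<close>.\<close>

lemma words_avoid:
  assumes U: "U \<subseteq> carrier G \<times> X" and V: "V \<subseteq> carrier G \<times> X"
    and N: "\<And>g x. g \<in> carrier G \<Longrightarrow> x \<in> X \<Longrightarrow> a g x \<in> N \<Longrightarrow> x \<in> N"
    and eq: "\<And>g x. x \<notin> N \<Longrightarrow> (g, x) \<in> U \<Longrightarrow> (g, x) \<in> V"
    and x: "x \<notin> N" and w: "(g, x) \<in> words G X a U k"
  shows "(g, x) \<in> words G X a V k"
  using w
proof (induction k arbitrary: g)
  case (Suc k)
  show ?case
  proof (cases "(g, x) \<in> words G X a U k")
    case False
    then obtain d h where d: "(h, x) \<in> words G X a U k" "(d, a h x) \<in> sym_arrows G a U" "g = d \<otimes> h"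
      using Suc.prems by auto
    have c: "h \<in> carrier G" "x \<in> X" "d \<in> carrier G"
      using d words_closed[OF U] sym_arrows_closed[OF U] by auto
    \<comment> \<open>The letter may be the reverse of an arrow of \<open>U\<close> based at
      \<open>a d (a h x)\<close>, so both of its endpoints have to avoid \<open>N\<close>.\<close>
    have "a h x \<notin> N" "a d (a h x) \<notin> N"
      using N[of h x] N[of d "a h x"] c x by (auto simp: act_closed)
    then have "(d, a h x) \<in> sym_arrows G a V"
      using d(2) eq by (auto simp: sym_arrows_iff[OF U] sym_arrows_iff[OF V] act_closed dest: subsetD[OF U])
    with Suc.IH[OF d(1)] d(3) show ?thesis by auto
  qed (use Suc in auto)
qed auto

end

text \<open>\<open>R\<close> is the graph of a factor map \<open>X \<rightarrow> Y\<close>, along which arrows are lifted.\<close>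

lemma words_lift:
  assumes X: "set_action G X a" and Y: "set_action G Y b"
    and R: "\<And>g x y. g \<in> carrier G \<Longrightarrow> x \<in> X \<Longrightarrow> y \<in> Y \<Longrightarrow> R x y \<Longrightarrow> R (a g x) (b g y)"
    and U: "U \<subseteq> carrier G \<times> Y"
    and x: "x \<in> X" "R x y" and w: "(g, y) \<in> words G Y b U k"
  shows "(g, x) \<in> words G X a {(g, x). x \<in> X \<and> (\<exists>y. (g, y) \<in> U \<and> R x y)} k"
  using w
proof (induction k arbitrary: g)
  case 0
  then show ?case using x by auto
next
  case (Suc k)
  interpret X: set_action G X a by fact
  interpret Y: set_action G Y b by fact
  let ?V = "{(g, x). x \<in> X \<and> (\<exists>y. (g, y) \<in> U \<and> R x y)}"
  have V: "?V \<subseteq> carrier G \<times> X" using U by auto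
  show ?case
  proof (cases "(g, y) \<in> words G Y b U k")
    case False
    then obtain d h where d: "(h, y) \<in> words G Y b U k" "(d, b h y) \<in> sym_arrows G b U" "g = d \<otimes>\<^bsub>G\<^esub> h"
      using Suc.prems by auto
    have c: "d \<in> carrier G" "h \<in> carrier G" "y \<in> Y"
      using d Y.words_closed[OF U] Y.sym_arrows_closed[OF U] by auto
    have "R (a h x) (b h y)" "R (a d (a h x)) (b d (b h y))"
      using c x R by (auto simp: X.act_closed Y.act_closed)
    then have "(d, a h x) \<in> sym_arrows G a ?V"
      using d(2) c x by (auto simp: X.sym_arrows_iff[OF V] Y.sym_arrows_iff[OF U] X.act_closed)
    with Suc.IH[OF d(1)] d(3) show ?thesis by auto
  qed (use Suc in auto)
qed

section \<open>Costs of action groupoids in terms of words\<close>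

lemma action_groupoid_sel [simp]:
  "arrows (action_groupoid G M a) = count_space (carrier G) \<Otimes>\<^sub>M M"
  "units (action_groupoid G M a) = {\<one>\<^bsub>G\<^esub>} \<times> space M"
  "src (action_groupoid G M a) (g, x) = x"
  "tgt (action_groupoid G M a) (g, x) = a g x"
  "gmult (action_groupoid G M a) (g, y) (h, x) = (g \<otimes>\<^bsub>G\<^esub> h, x)"
  "ginv (action_groupoid G M a) (g, x) = (inv\<^bsub>G\<^esub> g, a g x)"
  by (simp_all add: action_groupoid_def)

lemma sets_slice:
  assumes "U \<in> sets (count_space A \<Otimes>\<^sub>M M)"
  shows "{x \<in> space M. (g, x) \<in> U} \<in> sets M"
proof -
  have "{x \<in> space M. (g, x) \<in> U} = Pair g -` U"
    using sets.sets_into_space[OF assms] by (auto simp: space_pair_measure)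
  then show ?thesis using sets_Pair1[OF assms] by simp
qed

lemma sets_singleton_times:
  assumes "g \<in> A" "B \<in> sets M"
  shows "{g} \<times> B \<in> sets (count_space A \<Otimes>\<^sub>M M)"
  using assms by (intro pair_measureI) auto

lemma (in sigma_finite_measure) emeasure_singleton_times:
  assumes "g \<in> A" "B \<in> sets M"
  shows "emeasure (count_space A \<Otimes>\<^sub>M M) ({g} \<times> B) = emeasure M B"
  using assms by (subst emeasure_pair_measure_Times) auto

text \<open>Counting measure gives \<open>g\<close> mass 1, so a null set of arrows meets the slice
  over \<open>g\<close> in a null set.\<close>

lemma (in sigma_finite_measure) AE_slice:
  assumes "AE e in count_space A \<Otimes>\<^sub>M M. P e" and g: "g \<in> A"
  shows "AE x in M. P (g, x)"
proof -
  obtain N where N: "{e \<in> space (count_space A \<Otimes>\<^sub>M M). \<not> P e} \<subseteq> N"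
    "emeasure (count_space A \<Otimes>\<^sub>M M) N = 0" "N \<in> sets (count_space A \<Otimes>\<^sub>M M)"
    using assms(1) by (rule AE_E)
  let ?B = "{x \<in> space M. (g, x) \<in> N}"
  have B: "?B \<in> sets M" by (rule sets_slice[OF N(3)])
  have "emeasure M ?B = emeasure (count_space A \<Otimes>\<^sub>M M) ({g} \<times> ?B)"
    by (rule emeasure_singleton_times[OF g B, symmetric])
  also have "\<dots> \<le> emeasure (count_space A \<Otimes>\<^sub>M M) N"
    using N(3) by (intro emeasure_mono) auto
  finally have "?B \<in> null_sets M" using N(2) B by (intro null_setsI) auto
  then show ?thesis
    by (rule AE_I') (use N(1) g in \<open>auto simp: space_pair_measure\<close>)
qed

text \<open>Countable subadditivity: overlaps between members only raise the cost. Lower bounds for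
  the cost of a graphing are thereby reduced to the measure of its union.\<close>

lemma emeasure_UN_le_graphing_cost:
  assumes "graphing \<G> (I :: nat set) \<phi>"
  shows "emeasure (arrows \<G>) (\<Union>i\<in>I. \<phi> i) \<le> graphing_cost \<G> I \<phi>"
proof -
  define f where "f n = (if n \<in> I then \<phi> n else {})" for n
  have "(\<Union>i\<in>I. \<phi> i) = (\<Union>n. f n)" by (auto simp: f_def split: if_splits)
  also have "emeasure (arrows \<G>) \<dots> \<le> (\<Sum>n. emeasure (arrows \<G>) (f n))"
    using assms by (intro emeasure_subadditive_countably) (auto simp: f_def graphing_def bisection_def)
  also have "\<dots> \<le> graphing_cost \<G> I \<phi>"
    unfolding suminf_eq_SUP
  proof (rule SUP_least)
    fix n
    have "(\<Sum>i<n. emeasure (arrows \<G>) (f i)) = (\<Sum>i\<in>{..<n} \<inter> I. emeasure (arrows \<G>) (\<phi> i))"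
      by (rule sum.mono_neutral_cong_right) (auto simp: f_def)
    also have "\<dots> \<le> (SUP F\<in>{F. finite F \<and> F \<subseteq> I}. \<Sum>i\<in>F. emeasure (arrows \<G>) (\<phi> i))"
      by (rule SUP_upper) auto
    also have "\<dots> = graphing_cost \<G> I \<phi>"
      unfolding graphing_cost_def by (rule nonneg_infsum_complete[symmetric]) auto
    finally show "(\<Sum>i<n. emeasure (arrows \<G>) (f i)) \<le> graphing_cost \<G> I \<phi>" .
  qed
  finally show ?thesis .
qed

lemma graphing_sub_space:
  assumes "graphing (action_groupoid G M a) I \<phi>"
  shows "(\<Union>i\<in>I. \<phi> i) \<subseteq> carrier G \<times> space M"
proof -
  have "\<phi> i \<subseteq> carrier G \<times> space M" if "i \<in> I" for i
    using assms that sets.sets_into_space[of "\<phi> i" "count_space (carrier G) \<Otimes>\<^sub>M M"]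
    by (auto simp: graphing_def bisection_def space_pair_measure)
  then show ?thesis by blast
qed

lemma set_product_action:
  "set_product (action_groupoid G M a) A B = {(d \<otimes>\<^bsub>G\<^esub> g, x) |d g x. (d, a g x) \<in> A \<and> (g, x) \<in> B}"
  unfolding set_product_def by force

lemma ginv_image_action:
  "ginv (action_groupoid G M a) ` A = {(inv\<^bsub>G\<^esub> g, a g x) |g x. (g, x) \<in> A}"
  by force

text \<open>A product of sets consists of the products of their elements, and the sets allowed as
  factors have union \<open>sym_arrows\<close> of the union of the graphing. Hence the Lipschitz
  relation depends only on that union.\<close>

lemma bounded_products_eq_words:
  "bounded_products (action_groupoid G M a) L I \<phi> = words G (space M) a (\<Union>i\<in>I. \<phi> i) L"
proof -
  let ?\<G> = "action_groupoid G M a"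
  let ?C = "\<phi> ` I \<union> (\<lambda>i. ginv ?\<G> ` \<phi> i) ` I"
  let ?U = "\<Union>i\<in>I. \<phi> i"
  let ?W = "words G (space M) a ?U"
  have C: "\<Union>?C = sym_arrows G a ?U"
    by (auto simp: sym_arrows_def ginv_image_action)
  have le: "foldr (set_product ?\<G>) ws (units ?\<G>) \<subseteq> ?W (length ws)" if "set ws \<subseteq> ?C" for ws
    using that
  proof (induction ws)
    case (Cons w ws)
    then have w: "w \<subseteq> sym_arrows G a ?U" unfolding C[symmetric] by auto
    have IH: "foldr (set_product ?\<G>) ws (units ?\<G>) \<subseteq> ?W (length ws)" using Cons by simp
    show ?case
      unfolding foldr_Cons o_apply length_Cons words.simps set_product_action[of _ _ _ w] using w IH by blast
  qed simp
  have ge: "\<exists>ws. length ws \<le> k \<and> set ws \<subseteq> ?C \<and> (g, x) \<in> foldr (set_product ?\<G>) ws (units ?\<G>)"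
    if "(g, x) \<in> ?W k" for k g x
    using that
  proof (induction k arbitrary: g)
    case 0
    then show ?case by (intro exI[of _ "[]"]) simp
  next
    case (Suc k)
    show ?case
    proof (cases "(g, x) \<in> ?W k")
      case True
      with Suc.IH show ?thesis by (meson le_SucI)
    next
      case False
      then obtain d h where d: "(h, x) \<in> ?W k" "(d, a h x) \<in> sym_arrows G a ?U" "g = d \<otimes>\<^bsub>G\<^esub> h"
        using Suc.prems by auto
      obtain ws where ws: "length ws \<le> k" "set ws \<subseteq> ?C" "(h, x) \<in> foldr (set_product ?\<G>) ws (units ?\<G>)"
        using Suc.IH[OF d(1)] by blast
      obtain w where w: "w \<in> ?C" "(d, a h x) \<in> w" using d(2) unfolding C[symmetric] by blast
      have "(g, x) \<in> foldr (set_product ?\<G>) (w # ws) (units ?\<G>)"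
        using ws(3) w(2) d(3) by (auto simp: set_product_action)
      with ws w(1) show ?thesis by (intro exI[of _ "w # ws"]) auto
    qed
  qed
  show ?thesis
  proof (rule antisym)
    show "bounded_products ?\<G> L I \<phi> \<subseteq> ?W L"
    proof
      fix e assume "e \<in> bounded_products ?\<G> L I \<phi>"
      then obtain ws where ws: "length ws \<le> L" "set ws \<subseteq> ?C" "e \<in> foldr (set_product ?\<G>) ws (units ?\<G>)"
        unfolding bounded_products_def by blast
      then show "e \<in> ?W L"
        using le[OF ws(2)] words_mono[OF order_refl ws(1), of G "space M" a ?U] by blast
    qed
  next
    show "?W L \<subseteq> bounded_products ?\<G> L I \<phi>"
    proof
      fix e assume "e \<in> ?W L"
      then obtain ws where "length ws \<le> L" "set ws \<subseteq> ?C" "e \<in> foldr (set_product ?\<G>) ws (units ?\<G>)"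
        using ge[of "fst e" "snd e" L] by auto
      then show "e \<in> bounded_products ?\<G> L I \<phi>"
        unfolding bounded_products_def by blast
    qed
  qed
qed

text \<open>Words are closed under products and inverses, and induction on the length puts them into
  every subgroupoid that contains \<open>U\<close>. Generation thus means that each arrow has some
  finite word length.\<close>

lemma generated_subgroupoid_eq_words:
  assumes "set_action G (space M) a" and U: "U \<subseteq> carrier G \<times> space M"
  shows "generated_subgroupoid (action_groupoid G M a) U = (\<Union>k. words G (space M) a U k)"
proof -
  interpret set_action G "space M" a by fact
  let ?\<G> = "action_groupoid G M a"
  let ?W = "words G (space M) a U"
  have sub: "subgroupoid ?\<G> (\<Union>k. ?W k)"
    unfolding subgroupoid_def
  proof (intro conjI ballI impI)
    show "(\<Union>k. ?W k) \<subseteq> space (arrows ?\<G>)"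
      using words_closed[OF U] by (auto simp: space_pair_measure)
    have "units ?\<G> = ?W 0" by simp
    then show "units ?\<G> \<subseteq> (\<Union>k. ?W k)" by blast
  next
    fix e f assume "e \<in> (\<Union>k. ?W k)" "f \<in> (\<Union>k. ?W k)" "src ?\<G> e = tgt ?\<G> f"
    moreover obtain g y h x where "e = (g, y)" "f = (h, x)" by (cases e, cases f)
    ultimately show "gmult ?\<G> e f \<in> (\<Union>k. ?W k)"
      using words_mult[OF U] by auto blast
  next
    fix e assume "e \<in> (\<Union>k. ?W k)"
    then show "ginv ?\<G> e \<in> (\<Union>k. ?W k)"
      using words_inv[OF U] by (cases e) auto
  qed
  have "U \<subseteq> ?W 1" by (rule subset_words[OF U]) simp
  then have "generated_subgroupoid ?\<G> U \<subseteq> (\<Union>k. ?W k)"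
    using sub unfolding generated_subgroupoid_def by blast
  moreover have "?W k \<subseteq> K" if K: "subgroupoid ?\<G> K" "U \<subseteq> K" for K k
  proof (induction k)
    case 0
    then show ?case using K by (auto simp: subgroupoid_def)
  next
    case (Suc k)
    have inv: "ginv ?\<G> e \<in> K" if "e \<in> K" for e using K that by (auto simp: subgroupoid_def)
    have mult: "gmult ?\<G> e f \<in> K" if "e \<in> K" "f \<in> K" "src ?\<G> e = tgt ?\<G> f" for e f
      using K that by (auto simp: subgroupoid_def)
    have "sym_arrows G a U \<subseteq> K"
      using K(2) inv by (force simp: sym_arrows_def)
    then have "(d \<otimes>\<^bsub>G\<^esub> g, x) \<in> K" if "(g, x) \<in> ?W k" "(d, a g x) \<in> sym_arrows G a U" for d g x
      using mult[of "(d, a g x)" "(g, x)"] that Suc by auto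
    with Suc show ?case by auto
  qed
  then have "(\<Union>k. ?W k) \<subseteq> generated_subgroupoid ?\<G> U"
    unfolding generated_subgroupoid_def by blast
  ultimately show ?thesis by (rule antisym)
qed

text \<open>Each arrow \<open>(g, v)\<close> of \<open>U\<close> becomes the slice
  \<open>{g} \<times> P v\<close>, a bisection because translation by \<open>g\<close> is injective.
  The sets \<open>P v\<close> will be single points for a finite action and the fibres of a factor
  map otherwise.\<close>

lemma (in sigma_finite_measure) finite_graphing:
  fixes U :: "('g \<times> 'v) set" and P :: "'v \<Rightarrow> 'a set"
  assumes "set_action G (space M) a" and "finite U" "U \<subseteq> carrier G \<times> V"
    and P: "\<And>v. v \<in> V \<Longrightarrow> P v \<in> sets M" "\<And>v. v \<in> V \<Longrightarrow> emeasure M (P v) = c"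
  shows "\<exists>(J :: nat set) \<psi>. finite J \<and> graphing (action_groupoid G M a) J \<psi> \<and>
    (\<Union>j\<in>J. \<psi> j) = {(g, x). \<exists>v. (g, v) \<in> U \<and> x \<in> P v} \<and>
    graphing_cost (action_groupoid G M a) J \<psi> = of_nat (card U) * c"
proof -
  interpret set_action G "space M" a by fact
  obtain h where h: "bij_betw h {0..<card U} U"
    using ex_bij_betw_nat_finite[OF assms(2)] by blast
  define \<psi> where "\<psi> j = {fst (h j)} \<times> P (snd (h j))" for j
  have hj: "fst (h j) \<in> carrier G" "snd (h j) \<in> V" if "j \<in> {0..<card U}" for j
    using bij_betwE[OF h] that assms(3) by force+
  have bis: "bisection (action_groupoid G M a) (\<psi> j)" if j: "j \<in> {0..<card U}" for j
  proof -
    have "\<psi> j \<in> sets (count_space (carrier G) \<Otimes>\<^sub>M M)"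
      unfolding \<psi>_def by (intro sets_singleton_times hj[OF j] P)
    moreover have "P (snd (h j)) \<subseteq> space M"
      using P(1)[OF hj(2)[OF j]] by (rule sets.sets_into_space)
    then have "x = y" if "a (fst (h j)) x = a (fst (h j)) y" "x \<in> P (snd (h j))" "y \<in> P (snd (h j))" for x y
      using act_inj[OF hj(1)[OF j]] that by auto
    ultimately show ?thesis
      unfolding bisection_def by (auto simp: \<psi>_def inj_on_def)
  qed
  have "(\<Union>j\<in>{0..<card U}. \<psi> j) = (\<Union>e\<in>h ` {0..<card U}. {fst e} \<times> P (snd e))"
    by (auto simp: \<psi>_def)
  also have "\<dots> = {(g, x). \<exists>v. (g, v) \<in> U \<and> x \<in> P v}"
    unfolding bij_betw_imp_surj_on[OF h] by force
  finally have un: "(\<Union>j\<in>{0..<card U}. \<psi> j) = {(g, x). \<exists>v. (g, v) \<in> U \<and> x \<in> P v}" .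
  have "graphing_cost (action_groupoid G M a) {0..<card U} \<psi> = (\<Sum>j\<in>{0..<card U}. c)"
    unfolding graphing_cost_def using hj P
    by (subst infsum_finite, simp) (intro sum.cong refl, simp add: \<psi>_def emeasure_singleton_times)
  then show ?thesis
    using bis un by (intro exI[of _ "{0..<card U}"] exI[of _ \<psi>]) (auto simp: graphing_def)
qed

section \<open>Finite sets of arrows as competitors for the cost\<close>

locale generated_group = group G for G :: "('g, 'b) monoid_scheme" (structure) +
  fixes S :: "'g set"
  assumes finite_generators: "finite S"
    and generators_closed: "S \<subseteq> carrier G"
    and generate_eq: "generate G S = carrier G"
begin

lemma generated_word_ball: "g \<in> carrier G \<Longrightarrow> \<exists>k. g \<in> word_ball G S k"
  using generate_in_word_ball[OF generators_closed] generate_eq by simp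

lemma countable_carrier: "countable (carrier G)"
proof -
  have "carrier G \<subseteq> (\<Union>k. word_ball G S k)" using generated_word_ball by blast
  then show ?thesis
    by (rule countable_subset) (auto intro: countable_finite finite_word_ball finite_generators)
qed

end

text \<open>This is L-Lipschitz equivalence with the family of generators, written for the union of
  a graphing. Null sets are absent because on a finite action every arrow has positive mass.\<close>

definition admissible ::
  "('g, 'b) monoid_scheme \<Rightarrow> 'g set \<Rightarrow> 'x set \<Rightarrow> ('g \<Rightarrow> 'x \<Rightarrow> 'x) \<Rightarrow> nat \<Rightarrow> ('g \<times> 'x) set \<Rightarrow> bool" where
  "admissible G S X a L U \<longleftrightarrow>
    finite U \<and> U \<subseteq> words G X a (S \<times> X) L \<and> S \<times> X \<subseteq> words G X a U L"

definition finite_cost ::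
  "('g, 'b) monoid_scheme \<Rightarrow> 'g set \<Rightarrow> 'x set \<Rightarrow> ('g \<Rightarrow> 'x \<Rightarrow> 'x) \<Rightarrow> nat \<Rightarrow> ennreal" where
  "finite_cost G S X a L =
    (INF U \<in> {U. admissible G S X a L U}. of_nat (card U) * ennreal (1 / real (card X)))"

locale generated_action = generated_group G S + set_action G X a
  for G :: "('g, 'b) monoid_scheme" (structure) and S and X :: "'x set" and a
begin

lemma admissible_closed: "admissible G S X a L U \<Longrightarrow> U \<subseteq> carrier G \<times> X"
  unfolding admissible_def words_generators[OF generators_closed]
  using word_ball_closed[OF generators_closed, of L] by blast

lemma admissible_generates:
  assumes U: "admissible G S X a L U" and "g \<in> carrier G" "x \<in> X"
  shows "(g, x) \<in> (\<Union>k. words G X a U k)"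
proof -
  note U' = admissible_closed[OF U]
  have "g \<in> generate G S" using assms generate_eq by simp
  then show ?thesis using \<open>x \<in> X\<close>
  proof (induction arbitrary: x)
    case one
    then have "(\<one>, x) \<in> words G X a U 0" by simp
    then show ?case by blast
  next
    case (incl h)
    then have "(h, x) \<in> words G X a U L" using U by (auto simp: admissible_def)
    then show ?case by blast
  next
    case (inv h)
    then have h: "h \<in> carrier G" using generators_closed by auto
    \<comment> \<open>The generator is taken at the preimage of \<open>x\<close>, so that the
      reversed word starts at \<open>x\<close>.\<close>
    then have "(h, a (inv h) x) \<in> words G X a U L"
      using U inv by (auto simp: admissible_def act_closed)
    from words_inv[OF U' this] have "(inv h, x) \<in> words G X a U L"
      using h inv by (simp add: act_inv')
    then show ?case by blast
  next
    case (eng g h)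
    then have "a h x \<in> X" using generate_eq act_closed by auto
    with eng.IH(1)[of "a h x"] eng.IH(2)[of x] eng.prems show ?case
      using words_mult[OF U', of h x _ g] by blast
  qed
qed

end

text \<open>The hypotheses on \<open>R\<close> say that it is the graph of a measure preserving factor map.\<close>

lemma action_cost_le_finite_cost:
  assumes M: "sigma_finite_measure M"
    and X: "generated_action G S (space M) a" and V: "generated_action G S V b"
    and R: "\<And>g x v. g \<in> carrier G \<Longrightarrow> x \<in> space M \<Longrightarrow> v \<in> V \<Longrightarrow> R x v \<Longrightarrow> R (a g x) (b g v)"
    and total: "\<And>x. x \<in> space M \<Longrightarrow> \<exists>v\<in>V. R x v"
    and meas: "\<And>v. v \<in> V \<Longrightarrow> {x \<in> space M. R x v} \<in> sets M"
    and em: "\<And>v. v \<in> V \<Longrightarrow> emeasure M {x \<in> space M. R x v} = ennreal (1 / real (card V))"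
  shows "action_cost G M a \<le> finite_cost G S V b L"
  unfolding finite_cost_def
proof (rule INF_greatest, clarify)
  fix U assume U: "admissible G S V b L U"
  interpret M: sigma_finite_measure M by fact
  interpret X: generated_action G S "space M" a by fact
  interpret V: generated_action G S V b by fact
  have U': "U \<subseteq> carrier G \<times> V" by (rule V.admissible_closed[OF U])
  \<comment> \<open>The pull-back of \<open>U\<close> along \<open>R\<close>. All fibres have mass
    \<open>1 / card V\<close>, so cutting it into one bisection per arrow of \<open>U\<close> costs
    exactly what \<open>U\<close> costs, and lifted words show that it generates.\<close>
  let ?U = "{(g, x). x \<in> space M \<and> (\<exists>v. (g, v) \<in> U \<and> R x v)}"
  have "finite U" using U by (simp add: admissible_def)
  from M.finite_graphing[where P = "\<lambda>v. {x \<in> space M. R x v}", OF X.set_action_axioms this U' meas em]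
  obtain J :: "nat set" and \<psi> where J: "graphing (action_groupoid G M a) J \<psi>"
    "(\<Union>j\<in>J. \<psi> j) = {(g, x). \<exists>v. (g, v) \<in> U \<and> x \<in> {x \<in> space M. R x v}}"
    "graphing_cost (action_groupoid G M a) J \<psi> = of_nat (card U) * ennreal (1 / real (card V))"
    by blast
  have J2: "(\<Union>j\<in>J. \<psi> j) = ?U" unfolding J(2) by auto
  have "generated_subgroupoid (action_groupoid G M a) (\<Union>j\<in>J. \<psi> j) = (\<Union>k. words G (space M) a ?U k)"
    unfolding J2 by (rule generated_subgroupoid_eq_words[OF X.set_action_axioms]) (use U' in auto)
  moreover have "(g, x) \<in> (\<Union>k. words G (space M) a ?U k)" if g: "g \<in> carrier G" and x: "x \<in> space M" for g x
  proof -
    obtain v where v: "v \<in> V" "R x v" using total[OF x] by blast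
    then obtain k where "(g, v) \<in> words G V b U k"
      using V.admissible_generates[OF U g] by blast
    from words_lift[where R = R, OF X.set_action_axioms V.set_action_axioms R U' x v(2) this]
    show ?thesis by blast
  qed
  ultimately have "generating (action_groupoid G M a) J \<psi>"
    unfolding generating_def by (intro AE_I2) (auto simp: space_pair_measure)
  with J(1) have "action_cost G M a \<le> graphing_cost (action_groupoid G M a) J \<psi>"
    unfolding action_cost_def groupoid_cost_def by (intro INF_lower2[of "(J, \<psi>)"]) auto
  then show "action_cost G M a \<le> of_nat (card U) * ennreal (1 / real (card V))"
    by (simp add: J(3))
qed

locale finite_action = generated_action G S X a
  for G :: "('g, 'b) monoid_scheme" (structure) and S and X :: "'x set" and a +
  assumes finite_X: "finite X" and X_nonempty: "X \<noteq> {}"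
begin

abbreviation "\<mu> \<equiv> uniform_count_measure X"
abbreviation "\<G> \<equiv> action_groupoid G \<mu> a"

lemma prob_\<mu>: "prob_space \<mu>"
  by (rule prob_space_uniform_count_measure[OF finite_X X_nonempty])

lemma emeasure_point: "x \<in> X \<Longrightarrow> emeasure \<mu> {x} = ennreal (1 / real (card X))"
  by (subst emeasure_uniform_count_measure[OF finite_X]) auto

text \<open>Every single arrow has mass \<open>1 / card X\<close>, which is positive, so a property
  that fails at one arrow does not hold almost everywhere.\<close>

lemma AE_arrows_iff: "(AE e in arrows \<G>. P e) \<longleftrightarrow> (\<forall>e\<in>carrier G \<times> X. P e)"
proof
  assume *: "AE e in arrows \<G>. P e"
  interpret prob_space \<mu> by (rule prob_\<mu>)
  show "\<forall>e\<in>carrier G \<times> X. P e"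
  proof clarify
    fix g x assume gx: "g \<in> carrier G" "x \<in> X"
    have "AE e in count_space (carrier G) \<Otimes>\<^sub>M \<mu>. P e" using * by (simp only: action_groupoid_sel)
    then have "AE x in \<mu>. P (g, x)" using gx(1) by (rule AE_slice)
    then obtain N where N: "{x \<in> space \<mu>. \<not> P (g, x)} \<subseteq> N" "emeasure \<mu> N = 0" "N \<in> sets \<mu>"
      by (rule AE_E)
    have "x \<notin> N"
    proof
      assume "x \<in> N"
      then have "emeasure \<mu> {x} \<le> emeasure \<mu> N" using N(3) by (intro emeasure_mono) auto
      then have "card X = 0" using N(2) gx(2) by (simp add: emeasure_point)
      then show False using finite_X X_nonempty by simp
    qed
    then show "P (g, x)" using N(1) gx(2) by (auto simp: space_uniform_count_measure)
  qed
qed (auto simp: space_pair_measure space_uniform_count_measure intro!: AE_I2)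

lemma emeasure_arrows_finite:
  assumes "finite U" "U \<subseteq> carrier G \<times> X"
  shows "emeasure (arrows \<G>) U = of_nat (card U) * ennreal (1 / real (card X))"
proof -
  interpret prob_space \<mu> by (rule prob_\<mu>)
  have pt: "{(g, x)} \<in> sets (arrows \<G>) \<and> emeasure (arrows \<G>) {(g, x)} = ennreal (1 / real (card X))"
    if "(g, x) \<in> U" for g x
  proof -
    have gx: "g \<in> carrier G" "x \<in> X" "{(g, x)} = {g} \<times> {x}" using that assms by auto
    have x: "{x} \<in> sets \<mu>" using gx by (simp add: sets_uniform_count_measure)
    show ?thesis
      unfolding gx(3)
      using sets_singleton_times[OF gx(1) x] emeasure_singleton_times[OF gx(1) x] emeasure_point[OF gx(2)]
      by simp
  qed
  then have "emeasure (arrows \<G>) U = (\<Sum>e\<in>U. emeasure (arrows \<G>) {e})"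
    by (intro emeasure_eq_sum_singleton assms) auto
  also have "\<dots> = (\<Sum>e\<in>U. ennreal (1 / real (card X)))"
    using pt by (intro sum.cong) auto
  finally show ?thesis by simp
qed

text \<open>In one direction a graphing is replaced by its union, which is finite because it lies in
  a word ball times \<open>X\<close>; in the other a finite set of arrows is cut into one-point
  bisections.\<close>

lemma lipschitz_cost_eq: "lipschitz_cost L \<G> S (\<lambda>s. {s} \<times> space \<mu>) = finite_cost G S X a L"
proof -
  interpret prob_space \<mu> by (rule prob_\<mu>)
  have sp: "space \<mu> = X" by (simp add: space_uniform_count_measure)
  have gen: "(\<Union>s\<in>S. {s} \<times> X) = S \<times> X" by auto
  have sub: "lipschitz_subordinate \<G> L J \<psi> I \<phi> \<longleftrightarrow> (\<Union>j\<in>J. \<psi> j) \<subseteq> words G X a (\<Union>i\<in>I. \<phi> i) L"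
    if "(\<Union>j\<in>J. \<psi> j) \<subseteq> carrier G \<times> X" for J \<psi> I \<phi>
    unfolding lipschitz_subordinate_def AE_arrows_iff bounded_products_eq_words sp
    using that by blast
  have SX: "(\<Union>s\<in>S. {s} \<times> X) \<subseteq> carrier G \<times> X" using generators_closed by auto
  show ?thesis
  proof (rule antisym)
    show "finite_cost G S X a L \<le> lipschitz_cost L \<G> S (\<lambda>s. {s} \<times> space \<mu>)"
      unfolding lipschitz_cost_def
    proof (rule INF_greatest, clarify)
      fix J :: "nat set" and \<psi>
      assume J: "finite J" "graphing \<G> J \<psi>" "lipschitz_equivalent \<G> L J \<psi> S (\<lambda>s. {s} \<times> space \<mu>)"
      let ?U = "\<Union>j\<in>J. \<psi> j"
      have U: "?U \<subseteq> carrier G \<times> X" using graphing_sub_space[OF J(2)] by (simp add: sp)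
      have eqv: "?U \<subseteq> words G X a (S \<times> X) L" "S \<times> X \<subseteq> words G X a ?U L"
        using J(3) unfolding lipschitz_equivalent_def sp sub[OF U] sub[OF SX] gen by auto
      have "finite ?U"
        using eqv(1) unfolding words_generators[OF generators_closed]
        by (rule finite_subset) (auto intro: finite_X finite_word_ball finite_generators)
      with eqv have "finite_cost G S X a L \<le> of_nat (card ?U) * ennreal (1 / real (card X))"
        unfolding finite_cost_def by (intro INF_lower) (auto simp: admissible_def)
      also have "\<dots> \<le> graphing_cost \<G> J \<psi>"
        using emeasure_UN_le_graphing_cost[OF J(2)]
        unfolding emeasure_arrows_finite[OF \<open>finite ?U\<close> U] .
      finally show "finite_cost G S X a L \<le> graphing_cost \<G> J \<psi>" .
    qed
  next
    show "lipschitz_cost L \<G> S (\<lambda>s. {s} \<times> space \<mu>) \<le> finite_cost G S X a L"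
      unfolding finite_cost_def
    proof (rule INF_greatest, clarify)
      fix U assume U: "admissible G S X a L U"
      have U': "U \<subseteq> carrier G \<times> X" by (rule admissible_closed[OF U])
      have "\<exists>(J :: nat set) \<psi>. finite J \<and> graphing \<G> J \<psi> \<and>
        (\<Union>j\<in>J. \<psi> j) = {(g, x). \<exists>v. (g, v) \<in> U \<and> x \<in> {v}} \<and>
        graphing_cost \<G> J \<psi> = of_nat (card U) * ennreal (1 / real (card X))"
        by (rule finite_graphing[OF _ _ U'])
          (use U in \<open>auto simp: sp set_action_axioms admissible_def emeasure_point sets_uniform_count_measure\<close>)
      then obtain J :: "nat set" and \<psi> where J: "finite J" "graphing \<G> J \<psi>" "(\<Union>j\<in>J. \<psi> j) = U"
        "graphing_cost \<G> J \<psi> = of_nat (card U) * ennreal (1 / real (card X))" by auto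
      have "lipschitz_equivalent \<G> L J \<psi> S (\<lambda>s. {s} \<times> space \<mu>)"
        using U U' unfolding lipschitz_equivalent_def sp sub[OF SX] gen
        by (subst sub) (auto simp: J(3) gen admissible_def)
      with J have "lipschitz_cost L \<G> S (\<lambda>s. {s} \<times> space \<mu>) \<le> graphing_cost \<G> J \<psi>"
        unfolding lipschitz_cost_def by (intro INF_lower2[of "(J, \<psi>)"]) auto
      then show "lipschitz_cost L \<G> S (\<lambda>s. {s} \<times> space \<mu>) \<le> of_nat (card U) * ennreal (1 / real (card X))"
        by (simp add: J(4))
    qed
  qed
qed

text \<open>The factor map for the upper bound is the identity. For the lower bound only the
  finitely many arrows of \<open>S \<times> X\<close> have to be words in the graphing, so one
  truncation serves them all; it is admissible and no more expensive than the graphing.\<close>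

lemma action_cost_eq: "action_cost G \<mu> a = (INF L. finite_cost G S X a L)"
proof (rule antisym)
  interpret prob_space \<mu> by (rule prob_\<mu>)
  have sp: "space \<mu> = X" by (simp add: space_uniform_count_measure)
  show "action_cost G \<mu> a \<le> (INF L. finite_cost G S X a L)"
  proof (rule INF_greatest)
    fix L
    have ax: "generated_action G S (space \<mu>) a" unfolding sp by (rule generated_action_axioms)
    have one: "{x \<in> X. x = v} = {v}" if "v \<in> X" for v using that by auto
    show "action_cost G \<mu> a \<le> finite_cost G S X a L"
      by (rule action_cost_le_finite_cost[where R = "(=)", OF _ ax generated_action_axioms])
        (auto simp: sp one emeasure_point sets_uniform_count_measure sigma_finite_measure_axioms)
  qed
  show "(INF L. finite_cost G S X a L) \<le> action_cost G \<mu> a"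
    unfolding action_cost_def groupoid_cost_def
  proof (rule INF_greatest, clarify)
    fix I :: "nat set" and \<phi> assume I: "graphing \<G> I \<phi>" "generating \<G> I \<phi>"
    let ?U = "\<Union>i\<in>I. \<phi> i"
    have U: "?U \<subseteq> carrier G \<times> X" using graphing_sub_space[OF I(1)] by (simp add: sp)
    have ax: "set_action G (space \<mu>) a" unfolding sp by (rule set_action_axioms)
    have gen: "(g, x) \<in> (\<Union>k. words G X a ?U k)" if "g \<in> carrier G" "x \<in> X" for g x
      using I(2) that U unfolding generating_def AE_arrows_iff
      by (auto simp: generated_subgroupoid_eq_words[OF ax] sp)
    define V where "V K = ?U \<inter> word_ball G S K \<times> X" for K
    have "\<exists>K. e \<in> words G X a (V K) K" if e: "e \<in> S \<times> X" for e
    proof -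
      obtain s x where sx: "e = (s, x)" "s \<in> carrier G" "x \<in> X" using e generators_closed by auto
      then obtain k where "(s, x) \<in> words G X a ?U k" using gen by blast
      then show ?thesis
        using words_truncate[OF generators_closed generate_eq U] sx(1) by (simp add: V_def)
    qed
    then obtain f where f: "\<And>e. e \<in> S \<times> X \<Longrightarrow> e \<in> words G X a (V (f e)) (f e)" by metis
    \<comment> \<open>\<open>insert 0\<close> keeps the maximum meaningful when there are no
      generators.\<close>
    define K where "K = Suc (Max (insert 0 (f ` (S \<times> X))))"
    have "f e \<le> K" if "e \<in> S \<times> X" for e
      unfolding K_def using that finite_X finite_generators by (intro le_SucI Max_ge) auto
    moreover have "V k \<subseteq> V l" if "k \<le> l" for k l
      unfolding V_def using word_ball_mono[OF that, of G S] by blast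
    ultimately have "words G X a (V (f e)) (f e) \<subseteq> words G X a (V K) K" if "e \<in> S \<times> X" for e
      using that by (intro words_mono) auto
    then have "S \<times> X \<subseteq> words G X a (V K) K" using f by blast
    moreover have VK: "V K \<subseteq> words G X a (S \<times> X) K" "finite (V K)"
      unfolding V_def words_generators[OF generators_closed]
      by (auto intro!: finite_Int finite_X finite_word_ball finite_generators)
    ultimately have "admissible G S X a K (V K)"
      by (simp add: admissible_def)
    then have "(INF L. finite_cost G S X a L) \<le> of_nat (card (V K)) * ennreal (1 / real (card X))"
      unfolding finite_cost_def by (intro INF_lower2[of K] INF_lower) auto
    also have "\<dots> = emeasure (arrows \<G>) (V K)"
      by (rule emeasure_arrows_finite[symmetric, OF VK(2)]) (use U in \<open>auto simp: V_def\<close>)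
    also have "\<dots> \<le> emeasure (arrows \<G>) ?U"
      using I(1) by (intro emeasure_mono sets.countable_UN') (auto simp: V_def graphing_def bisection_def)
    also have "\<dots> \<le> graphing_cost \<G> I \<phi>"
      by (rule emeasure_UN_le_graphing_cost[OF I(1)])
    finally show "(INF L. finite_cost G S X a L) \<le> graphing_cost \<G> I \<phi>" .
  qed
qed

end

section \<open>Comparison with the Schreier graphs\<close>

lemma graph_dist_le_iff:
  "graph_dist E x y \<le> enat L \<longleftrightarrow> (\<exists>k\<le>L. (x, y) \<in> {(v, w). {v, w} \<in> E} ^^ k)"
proof
  assume *: "graph_dist E x y \<le> enat L"
  show "\<exists>k\<le>L. (x, y) \<in> {(v, w). {v, w} \<in> E} ^^ k"
  proof (rule ccontr)
    assume "\<not> ?thesis"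
    then have "Suc L \<le> k" if "(x, y) \<in> {(v, w). {v, w} \<in> E} ^^ k" for k
      using that by (meson not_less_eq_eq)
    then have "enat (Suc L) \<le> graph_dist E x y"
      unfolding graph_dist_def by (intro INF_greatest) auto
    then have "enat (Suc L) \<le> enat L" using * by (rule order_trans)
    then show False by simp
  qed
next
  assume "\<exists>k\<le>L. (x, y) \<in> {(v, w). {v, w} \<in> E} ^^ k"
  then show "graph_dist E x y \<le> enat L"
    unfolding graph_dist_def by (auto intro: INF_lower2)
qed

definition arrow_edges :: "('g \<Rightarrow> 'x \<Rightarrow> 'x) \<Rightarrow> ('g \<times> 'x) set \<Rightarrow> 'x set set" where
  "arrow_edges a U = (\<lambda>(g, x). {x, a g x}) ` U"

lemma ennreal_of_nat_divide: "ennreal (real n / real m) = of_nat n * ennreal (1 / real m)"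
  by (simp add: ennreal_of_nat_eq_real_of_nat flip: ennreal_mult)

context set_action begin

lemma sym_arrows_edge:
  assumes U: "U \<subseteq> carrier G \<times> X" and "(d, y) \<in> sym_arrows G a U"
  shows "{y, a d y} \<in> arrow_edges a U"
proof -
  have "(d, y) \<in> U \<or> (d \<in> carrier G \<and> y \<in> X \<and> (inv d, a d y) \<in> U)"
    using assms(2) by (simp only: sym_arrows_iff[OF U])
  then show ?thesis
  proof
    assume d: "d \<in> carrier G \<and> y \<in> X \<and> (inv d, a d y) \<in> U"
    then have "{y, a d y} = {a d y, a (inv d) (a d y)}" by (auto simp: act_inv)
    with d show ?thesis unfolding arrow_edges_def by force
  qed (force simp: arrow_edges_def)
qed

lemma edge_sym_arrows:
  assumes U: "U \<subseteq> carrier G \<times> X" and "{y, z} \<in> arrow_edges a U"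
  shows "\<exists>d. (d, y) \<in> sym_arrows G a U \<and> a d y = z"
proof -
  obtain g x where gx: "(g, x) \<in> U" "{y, z} = {x, a g x}"
    using assms(2) by (auto simp: arrow_edges_def)
  have c: "g \<in> carrier G" "x \<in> X" using gx U by auto
  from gx(2) consider "y = x" "z = a g x" | "y = a g x" "z = x" by (auto simp: doubleton_eq_iff)
  then show ?thesis
  proof cases
    case 1
    then show ?thesis using gx(1) by (auto simp: sym_arrows_def)
  next
    case 2
    then have "(inv g, y) \<in> sym_arrows G a U" "a (inv g) y = z"
      using gx(1) c by (auto simp: sym_arrows_def act_inv)
    then show ?thesis by blast
  qed
qed

lemma words_path:
  assumes U: "U \<subseteq> carrier G \<times> X" and "(g, x) \<in> words G X a U k"
  shows "\<exists>j\<le>k. (x, a g x) \<in> {(v, w). {v, w} \<in> arrow_edges a U} ^^ j"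
  using assms(2)
proof (induction k arbitrary: g)
  case 0
  then show ?case by (auto simp: act_one)
next
  case (Suc k)
  show ?case
  proof (cases "(g, x) \<in> words G X a U k")
    case True
    with Suc.IH show ?thesis by (meson le_SucI)
  next
    case False
    then obtain d h where d: "(h, x) \<in> words G X a U k" "(d, a h x) \<in> sym_arrows G a U" "g = d \<otimes> h"
      using Suc.prems by auto
    have c: "d \<in> carrier G" "h \<in> carrier G" "x \<in> X"
      using d words_closed[OF U] sym_arrows_closed[OF U] by auto
    obtain j where j: "j \<le> k" "(x, a h x) \<in> {(v, w). {v, w} \<in> arrow_edges a U} ^^ j"
      using Suc.IH[OF d(1)] by blast
    have "(a h x, a g x) \<in> {(v, w). {v, w} \<in> arrow_edges a U}"
      using sym_arrows_edge[OF U d(2)] c d(3) by (simp add: act_mult)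
    with j have "(x, a g x) \<in> {(v, w). {v, w} \<in> arrow_edges a U} ^^ Suc j"
      by (intro relpow_Suc_I)
    with j(1) show ?thesis by (intro exI[of _ "Suc j"]) simp
  qed
qed

text \<open>Every step of the walk receives some letter that realizes it. The choice is arbitrary,
  so only the endpoint is controlled and not the group element.\<close>

lemma path_words:
  assumes U: "U \<subseteq> carrier G \<times> X" and x: "x \<in> X"
    and "(x, y) \<in> {(v, w). {v, w} \<in> arrow_edges a U} ^^ k"
  shows "\<exists>g. (g, x) \<in> words G X a U k \<and> a g x = y"
  using assms(3)
proof (induction k arbitrary: y)
  case 0
  then show ?case using x by (auto intro!: exI[of _ \<one>] simp: act_one)
next
  case (Suc k)
  from Suc.prems obtain z where z: "(x, z) \<in> {(v, w). {v, w} \<in> arrow_edges a U} ^^ k"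
    "{z, y} \<in> arrow_edges a U" by auto
  obtain g where g: "(g, x) \<in> words G X a U k" "a g x = z" using Suc.IH[OF z(1)] by blast
  obtain d where d: "(d, z) \<in> sym_arrows G a U" "a d z = y" using edge_sym_arrows[OF U z(2)] by blast
  have "d \<in> carrier G" "g \<in> carrier G"
    using d g words_closed[OF U] sym_arrows_closed[OF U] by auto
  then have "a (d \<otimes> g) x = y" using x g d by (simp add: act_mult)
  moreover have "(d \<otimes> g, x) \<in> words G X a U (Suc k)" using g d by auto
  ultimately show ?case by blast
qed

end

context finite_action begin

text \<open>Forgetting labels turns words into walks that are no longer than the words, and it can
  only merge arrows, so there are at most as many edges as arrows.\<close>

lemma graph_lipschitz_cost_le:
  "graph_lipschitz_cost L X (arrow_edges a (S \<times> X)) \<le> finite_cost G S X a L"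
  unfolding finite_cost_def
proof (rule INF_greatest, clarify)
  fix U assume adm: "admissible G S X a L U"
  have U: "U \<subseteq> carrier G \<times> X" by (rule admissible_closed[OF adm])
  have SX: "S \<times> X \<subseteq> carrier G \<times> X" using generators_closed by auto
  have dist: "graph_dist (arrow_edges a B) x y \<le> enat L"
    if B: "B \<subseteq> carrier G \<times> X" and A: "A \<subseteq> carrier G \<times> X" and sub: "A \<subseteq> words G X a B L"
      and e: "{x, y} \<in> arrow_edges a A"
    for A B x y
  proof -
    obtain d where d: "(d, x) \<in> sym_arrows G a A" "a d x = y" using edge_sym_arrows[OF A e] by blast
    have "sym_arrows G a A \<subseteq> words G X a B L"
      using sub words_inv[OF B] by (auto simp: sym_arrows_def)
    then show ?thesis using words_path[OF B, of d x L] d by (auto simp: graph_dist_le_iff)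
  qed
  have "graph_on X (arrow_edges a U)"
    unfolding graph_on_def arrow_edges_def
  proof clarify
    fix g x assume "(g, x) \<in> U"
    then have "x \<in> X" "a g x \<in> X" using U act_closed by auto
    then show "\<exists>y z. {x, a g x} = {y, z} \<and> y \<in> X \<and> z \<in> X" by blast
  qed
  then have "graph_lipschitz_cost L X (arrow_edges a (S \<times> X))
      \<le> ennreal (real (card (arrow_edges a U)) / real (card X))"
    unfolding graph_lipschitz_cost_def using adm dist[OF SX U] dist[OF U SX]
    by (intro INF_lower) (auto simp: admissible_def)
  also have "\<dots> \<le> ennreal (real (card U) / real (card X))"
    using adm unfolding arrow_edges_def
    by (intro ennreal_leI divide_right_mono) (auto simp: admissible_def intro!: card_image_le)
  finally show "graph_lipschitz_cost L X (arrow_edges a (S \<times> X))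
      \<le> of_nat (card U) * ennreal (1 / real (card X))"
    by (simp only: ennreal_of_nat_divide)
qed

text \<open>
  A path in a Lipschitz equivalent graph determines a group element only up to the stabilizer of
  its starting point. The points with a nontrivial short stabilizing element are treated
  separately, by adding all generators there.
\<close>

lemma finite_cost_le:
  fixes L :: nat
  defines "bad \<equiv> {x \<in> X. \<exists>g\<in>word_ball G S (Suc (L * L)) - {\<one>}. a g x = x}"
  shows "finite_cost G S X a (max L 1) \<le> graph_lipschitz_cost L X (arrow_edges a (S \<times> X))
    + ennreal (real (card S) * real (card bad) / real (card X))"
proof -
  have SX: "S \<times> X \<subseteq> carrier G \<times> X" using generators_closed by auto
  have "finite_cost G S X a (max L 1) \<le> ennreal (real (card F) / real (card X))
      + ennreal (real (card S) * real (card bad) / real (card X))"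
    if F: "graph_on X F"
      and FE: "\<And>x y. {x, y} \<in> F \<Longrightarrow> graph_dist (arrow_edges a (S \<times> X)) x y \<le> enat L"
      and EF: "\<And>x y. {x, y} \<in> arrow_edges a (S \<times> X) \<Longrightarrow> graph_dist F x y \<le> enat L"
    for F
  proof -
    have "F \<subseteq> Pow X" using F by (auto simp: graph_on_def)
    then have finF: "finite F" by (rule finite_subset) (simp add: finite_X)
    have "\<forall>e\<in>F. \<exists>d. d \<in> word_ball G S L \<times> X \<and> e = (\<lambda>(g, x). {x, a g x}) d"
    proof
      fix e assume e: "e \<in> F"
      obtain x y where xy: "e = {x, y}" "x \<in> X" "y \<in> X" using e F by (auto simp: graph_on_def)
      then obtain k where k: "k \<le> L" "(x, y) \<in> {(v, w). {v, w} \<in> arrow_edges a (S \<times> X)} ^^ k"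
        using FE[of x y] e by (auto simp: graph_dist_le_iff)
      then obtain g where g: "(g, x) \<in> words G X a (S \<times> X) k" "a g x = y"
        using path_words[OF SX xy(2) k(2)] by blast
      then have "g \<in> word_ball G S L" "e = {x, a g x}"
        using k(1) word_ball_mono[of k L G S] xy by (auto simp: words_generators[OF generators_closed])
      then show "\<exists>d. d \<in> word_ball G S L \<times> X \<and> e = (\<lambda>(g, x). {x, a g x}) d"
        using xy(2) by (intro exI[of _ "(g, x)"]) simp
    qed
    from bchoice[OF this] obtain f
      where f: "\<forall>e\<in>F. f e \<in> word_ball G S L \<times> X \<and> e = (\<lambda>(g, x). {x, a g x}) (f e)" ..
    have f1: "f e \<in> word_ball G S L \<times> X" if "e \<in> F" for e
      by (rule conjunct1[OF bspec[OF f that]])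
    have f2: "(\<lambda>(g, x). {x, a g x}) (f e) = e" if "e \<in> F" for e
      by (rule conjunct2[OF bspec[OF f that], symmetric])
    have edges: "arrow_edges a (f ` F) = F"
    proof -
      have "arrow_edges a (f ` F) = (\<lambda>e. (\<lambda>(g, x). {x, a g x}) (f e)) ` F"
        by (simp only: arrow_edges_def image_image)
      also have "\<dots> = (\<lambda>e. e) ` F" by (intro image_cong refl f2)
      finally show ?thesis by simp
    qed
    have fF: "f ` F \<subseteq> word_ball G S L \<times> X" by (intro image_subsetI f1)
    have fF': "f ` F \<subseteq> carrier G \<times> X"
      by (rule order_trans[OF fF Sigma_mono[OF word_ball_closed[OF generators_closed] order_refl]])
    \<comment> \<open>At bad points the generators are themselves letters; this is why the constant
      is \<open>max L 1\<close>, which allows one-letter words even for L = 0. Elsewhere the arrows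
      chosen along \<open>F\<close> have to produce the generators.\<close>
    define U where "U = f ` F \<union> S \<times> bad"
    have badX: "bad \<subseteq> X" unfolding bad_def by auto
    then have fin_bad: "finite bad" using finite_X by (rule finite_subset)
    have U: "U \<subseteq> carrier G \<times> X" using fF' generators_closed badX unfolding U_def by auto
    have "U \<subseteq> words G X a (S \<times> X) (max L 1)"
    proof -
      have "f ` F \<subseteq> words G X a (S \<times> X) (max L 1)"
        unfolding words_generators[OF generators_closed]
        by (rule order_trans[OF fF Sigma_mono[OF word_ball_mono order_refl]]) simp
      moreover have "S \<times> X \<subseteq> words G X a (S \<times> X) (max L 1)"
        by (rule subset_words[OF SX]) simp
      ultimately show ?thesis using badX unfolding U_def by blast
    qed
    moreover have "(s, x) \<in> words G X a U (max L 1)" if s: "s \<in> S" and x: "x \<in> X" for s x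
    proof (cases "x \<in> bad")
      case True
      then have "(s, x) \<in> U" using s by (simp add: U_def)
      then show ?thesis using subset_words[OF U, of "max L 1"] by auto
    next
      case False
      have sc: "s \<in> carrier G" using s generators_closed by auto
      have "{x, a s x} \<in> arrow_edges a (S \<times> X)" using s x by (force simp: arrow_edges_def)
      from EF[OF this] obtain k where k: "k \<le> L" "(x, a s x) \<in> {(v, w). {v, w} \<in> F} ^^ k"
        by (auto simp: graph_dist_le_iff)
      then obtain d where d: "(d, x) \<in> words G X a (f ` F) k" "a d x = a s x"
        using path_words[OF fF' x, of "a s x" k] unfolding edges by blast
      have dL: "(d, x) \<in> words G X a (f ` F) L"
        using d(1) words_mono[OF order_refl k(1)] by blast
      then have dball: "d \<in> word_ball G S (L * L)"
        using words_word_ball[OF generators_closed fF] by blast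
      then have dc: "d \<in> carrier G" using word_ball_closed[OF generators_closed] by blast
      have "inv s \<in> word_ball G S (Suc 0)"
        using s by (intro generators_in_word_ball generators_closed) auto
      \<comment> \<open>At most L letters, each of length at most L, give \<open>d\<close> length at
        most \<open>L * L\<close>; the further letter \<open>inv s\<close> explains the radius
        \<open>Suc (L * L)\<close> in \<open>bad\<close>.\<close>
      then have "inv s \<otimes> d \<in> word_ball G S (Suc 0 + L * L)"
        using dball by (rule word_ball_mult[OF generators_closed])
      moreover have "a (inv s \<otimes> d) x = x"
        using sc dc x d(2) by (simp add: act_mult act_inv)
      ultimately have "inv s \<otimes> d = \<one>" using False x unfolding bad_def by auto
      then have "d = s" using sc dc by (metis inv_closed inv_equality inv_inv)
      then show ?thesis
        using dL words_mono[of "f ` F" U L "max L 1" G X a] by (auto simp: U_def)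
    qed
    moreover have "finite U" using finF fin_bad finite_generators by (simp add: U_def)
    ultimately have "admissible G S X a (max L 1) U" by (auto simp: admissible_def)
    then have "finite_cost G S X a (max L 1) \<le> ennreal (real (card U) / real (card X))"
      unfolding finite_cost_def ennreal_of_nat_divide by (intro INF_lower) auto
    also have "\<dots> \<le> ennreal (real (card F) / real (card X) + real (card S) * real (card bad) / real (card X))"
    proof (rule ennreal_leI)
      have "card U \<le> card (f ` F) + card (S \<times> bad)" unfolding U_def by (rule card_Un_le)
      also have "\<dots> \<le> card F + card S * card bad"
        using finF by (simp add: card_image_le card_cartesian_product)
      finally have "real (card U) \<le> real (card F) + real (card S) * real (card bad)"
        by (metis of_nat_add of_nat_le_iff of_nat_mult)
      then show "real (card U) / real (card X)
          \<le> real (card F) / real (card X) + real (card S) * real (card bad) / real (card X)"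
        unfolding add_divide_distrib[symmetric] by (rule divide_right_mono) simp
    qed
    finally show ?thesis by (simp add: ennreal_plus)
  qed
  \<comment> \<open>The error term is the same for every \<open>F\<close>. Moved to the left by
    truncated subtraction, it leaves a bound over which the infimum can be taken.\<close>
  then have "finite_cost G S X a (max L 1) - ennreal (real (card S) * real (card bad) / real (card X))
      \<le> graph_lipschitz_cost L X (arrow_edges a (S \<times> X))"
    unfolding graph_lipschitz_cost_def
    by (intro INF_greatest) (auto simp: ennreal_minus_le_iff add.commute)
  then show ?thesis by (simp add: ennreal_minus_le_iff add.commute)
qed

end

section \<open>Coset actions along a chain of subgroups\<close>

context group begin

lemma lcosets_non_empty: "lcosets K \<noteq> {}"
  by (auto simp: LCOSETS_def)

lemma lcoset_sub_carrier: "subgroup K G \<Longrightarrow> x \<in> lcosets K \<Longrightarrow> x \<subseteq> carrier G"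
  using lcosets_subset_PowG by blast

lemma coset_action_mono: "x \<subseteq> y \<Longrightarrow> coset_action G g x \<subseteq> coset_action G g y"
  by (auto simp: coset_action_def l_coset_def)

lemma set_action_coset:
  assumes K: "subgroup K G"
  shows "set_action G (lcosets K) (coset_action G)"
proof
  fix g x assume gx: "g \<in> carrier G" "x \<in> lcosets K"
  then obtain h where h: "h \<in> carrier G" "x = h <# K" by (auto simp: LCOSETS_def)
  have "coset_action G g x = (g \<otimes> h) <# K"
    unfolding coset_action_def h(2) by (rule lcos_m_assoc[OF subgroup.subset[OF K] gx(1) h(1)])
  then show "coset_action G g x \<in> lcosets K" using gx(1) h(1) by (auto simp: LCOSETS_def)
next
  fix x assume "x \<in> lcosets K"
  then show "coset_action G \<one> x = x"
    unfolding coset_action_def by (intro lcos_mult_one lcoset_sub_carrier[OF K])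
next
  fix g h x assume "g \<in> carrier G" "h \<in> carrier G" "x \<in> lcosets K"
  then show "coset_action G (g \<otimes> h) x = coset_action G g (coset_action G h x)"
    unfolding coset_action_def by (intro lcos_m_assoc[symmetric] lcoset_sub_carrier[OF K])
qed

lemma coset_action_transitive:
  assumes K: "subgroup K G" and v: "v \<in> lcosets K" and w: "w \<in> lcosets K"
  shows "\<exists>g\<in>carrier G. coset_action G g v = w"
proof -
  obtain h k where h: "h \<in> carrier G" "v = h <# K" and k: "k \<in> carrier G" "w = k <# K"
    using v w by (auto simp: LCOSETS_def)
  have "coset_action G (k \<otimes> inv h) v = ((k \<otimes> inv h) \<otimes> h) <# K"
    unfolding coset_action_def h(2) using h(1) k(1) by (intro lcos_m_assoc subgroup.subset[OF K]) auto
  also have "(k \<otimes> inv h) \<otimes> h = k" using h(1) k(1) by (simp add: m_assoc)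
  finally show ?thesis using h(1) k by blast
qed

lemma lcoset_sub_ex:
  assumes "K \<subseteq> K'" "x \<in> lcosets K"
  shows "\<exists>v\<in>lcosets K'. x \<subseteq> v"
proof -
  obtain h where h: "h \<in> carrier G" "x = h <# K" using assms(2) by (auto simp: LCOSETS_def)
  have "h <# K' \<in> lcosets K'" using h(1) by (auto simp: LCOSETS_def)
  moreover have "h <# K \<subseteq> h <# K'" using assms(1) by (auto simp: l_coset_def)
  ultimately show ?thesis using h(2) by blast
qed

lemma lcoset_sub_unique:
  assumes K: "subgroup K G" "subgroup K' G" and x: "x \<in> lcosets K"
    and v: "v \<in> lcosets K'" "x \<subseteq> v" and w: "w \<in> lcosets K'" "x \<subseteq> w"
  shows "v = w"
proof (rule ccontr)
  assume "v \<noteq> w"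
  then have "v \<inter> w = {}" using lcos_disjoint[OF K(2) v(1) w(1)] by simp
  moreover obtain h where "h \<in> carrier G" "x = h <# K" using x by (auto simp: LCOSETS_def)
  then have "h \<in> x" using lcos_self[OF _ K(1)] by simp
  ultimately show False using v(2) w(2) by blast
qed

text \<open>Translations act transitively on the cosets of \<open>K'\<close> and carry fibres
  injectively into fibres, so all fibres have the same size, and counting over the disjoint fibres
  gives the product. This is what makes the projection measure preserving.\<close>

lemma card_lcoset_fiber:
  assumes K: "subgroup K G" "subgroup K' G" "K \<subseteq> K'"
    and fin: "finite (lcosets K)" "finite (lcosets K')" and v: "v \<in> lcosets K'"
  shows "card {x \<in> lcosets K. x \<subseteq> v} * card (lcosets K') = card (lcosets K)"
proof -
  interpret act: set_action G "lcosets K" "coset_action G" by (rule set_action_coset[OF K(1)])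
  let ?f = "\<lambda>v. {x \<in> lcosets K. x \<subseteq> v}"
  have le: "card (?f v) \<le> card (?f w)" if vw: "v \<in> lcosets K'" "w \<in> lcosets K'" for v w
  proof -
    obtain g where g: "g \<in> carrier G" "coset_action G g v = w"
      using coset_action_transitive[OF K(2) vw] by blast
    have "inj_on (coset_action G g) (?f v)"
      using act.act_inj[OF g(1)] by (intro inj_onI) auto
    moreover have "coset_action G g ` ?f v \<subseteq> ?f w"
      using coset_action_mono[of _ v g] act.act_closed[OF g(1)] g(2) by auto
    ultimately show ?thesis by (rule card_inj_on_le) (simp add: fin)
  qed
  have "lcosets K = (\<Union>w\<in>lcosets K'. ?f w)" using lcoset_sub_ex[OF K(3)] by auto
  then have "card (lcosets K) = card (\<Union>w\<in>lcosets K'. ?f w)" by simp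
  also have "\<dots> = (\<Sum>w\<in>lcosets K'. card (?f w))"
    using fin lcoset_sub_unique[OF K(1,2)] by (intro card_UN_disjoint) auto
  also have "\<dots> = (\<Sum>w\<in>lcosets K'. card (?f v))"
    using le v by (intro sum.cong refl antisym) auto
  finally show ?thesis by simp
qed

end

section \<open>Costs along the chain of coset spaces\<close>

locale farber_chain = generated_group G S
  for G :: "('g, 'b) monoid_scheme" (structure) and S +
  fixes H :: "nat \<Rightarrow> 'g set"
  assumes farber: "farber_sequence G H" and nested: "nested_sequence H"
begin

abbreviation "V n \<equiv> lcosets (H n)"
abbreviation "act \<equiv> coset_action G"
abbreviation "cost L n \<equiv> finite_cost G S (V n) act L"

text \<open>Since costs decrease along the chain, all the invariants of the theorem equal this number.\<close>

definition chain_cost :: ennreal where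
  "chain_cost = (INF L. INF n. cost L n)"

lemma subgroup_H: "subgroup (H n) G" and finite_V: "finite (V n)"
  using farber by (auto simp: farber_sequence_def)

lemma H_antimono: "n \<le> m \<Longrightarrow> H m \<subseteq> H n"
  by (rule lift_Suc_antimono_le) (use nested in \<open>auto simp: nested_sequence_def\<close>)

lemma finite_action_V: "finite_action G S (V n) act"
  by (intro finite_action.intro generated_action.intro finite_action_axioms.intro
      generated_group_axioms set_action_coset subgroup_H finite_V lcosets_non_empty)

lemma generated_action_V: "generated_action G S (V n) act"
  by (intro generated_action.intro generated_group_axioms set_action_coset subgroup_H)

lemma coset_measure_eq: "coset_measure G (H n) = uniform_count_measure (V n)"
  by (simp add: coset_measure_def)

lemma card_fiber: "n \<le> m \<Longrightarrow> v \<in> V n \<Longrightarrow> card {x \<in> V m. x \<subseteq> v} * card (V n) = card (V m)"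
  by (intro card_lcoset_fiber subgroup_H H_antimono finite_V)

lemma card_V_pos: "0 < card (V n)"
  using finite_V[of n] lcosets_non_empty[of "H n"] by (simp add: card_gt_0_iff)

lemma emeasure_fiber:
  assumes "n \<le> m" "v \<in> V n"
  shows "emeasure (coset_measure G (H m)) {x \<in> V m. x \<subseteq> v} = ennreal (1 / real (card (V n)))"
proof -
  have "real (card {x \<in> V m. x \<subseteq> v}) * real (card (V n)) = real (card (V m))"
    using card_fiber[OF assms] by (metis of_nat_mult)
  then have "real (card {x \<in> V m. x \<subseteq> v}) / real (card (V m)) = 1 / real (card (V n))"
    using card_V_pos[of n] card_V_pos[of m] by (simp add: field_simps)
  then show ?thesis
    unfolding coset_measure_eq by (subst emeasure_uniform_count_measure) (auto simp: finite_V)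
qed

text \<open>Inclusion of cosets is the graph of the projection from \<open>V m\<close> to
  \<open>V n\<close>. Pulling a set of arrows back along it does not raise the normalized
  cardinality, as all fibres have equal size, and words lift with their length, so the same L
  works.\<close>

lemma cost_antimono:
  assumes nm: "n \<le> m"
  shows "cost L m \<le> cost L n"
  unfolding finite_cost_def[of G S "V n"]
proof (rule INF_greatest, clarify)
  fix U assume U: "admissible G S (V n) act L U"
  interpret n: generated_action G S "V n" act by (rule generated_action_V)
  interpret m: generated_action G S "V m" act by (rule generated_action_V)
  have U': "U \<subseteq> carrier G \<times> V n" by (rule n.admissible_closed[OF U])
  let ?U = "{(g, x). x \<in> V m \<and> (\<exists>y. (g, y) \<in> U \<and> x \<subseteq> y)}"
  have un: "?U = (\<Union>(g, v)\<in>U. {g} \<times> {x \<in> V m. x \<subseteq> v})" by auto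
  have finU: "finite U" using U by (simp add: admissible_def)
  have finU': "finite ?U" unfolding un using finU by (auto simp: finite_V)
  have "(s, x) \<in> words G (V m) act ?U L" if "s \<in> S" "x \<in> V m" for s x
  proof -
    obtain v where v: "v \<in> V n" "x \<subseteq> v" using lcoset_sub_ex[OF H_antimono[OF nm]] \<open>x \<in> V m\<close> by blast
    then have "(s, v) \<in> words G (V n) act U L" using U \<open>s \<in> S\<close> by (auto simp: admissible_def)
    from words_lift[where R = "(\<subseteq>)", OF m.set_action_axioms n.set_action_axioms
        _ U' \<open>x \<in> V m\<close> v(2) this]
    show ?thesis by (simp add: coset_action_mono)
  qed
  moreover have "?U \<subseteq> words G (V m) act (S \<times> V m) L"
    using U unfolding admissible_def n.words_generators[OF generators_closed]
      m.words_generators[OF generators_closed] by auto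
  ultimately have "admissible G S (V m) act L ?U"
    using finU' by (auto simp: admissible_def)
  then have "cost L m \<le> of_nat (card ?U) * ennreal (1 / real (card (V m)))"
    unfolding finite_cost_def by (intro INF_lower) auto
  also have "\<dots> = ennreal (real (card ?U) / real (card (V m)))"
    by (rule ennreal_of_nat_divide[symmetric])
  also have "\<dots> \<le> ennreal (real (card U) / real (card (V n)))"
  proof (rule ennreal_leI)
    have fib: "real (card {x \<in> V m. x \<subseteq> v}) = real (card (V m)) / real (card (V n))" if "v \<in> V n" for v
    proof -
      have "real (card {x \<in> V m. x \<subseteq> v}) * real (card (V n)) = real (card (V m))"
        using card_fiber[OF nm that] by (metis of_nat_mult)
      then show ?thesis using card_V_pos[of n] by (simp add: field_simps)
    qed
    have "card ?U \<le> (\<Sum>(g, v)\<in>U. card ({g} \<times> {x \<in> V m. x \<subseteq> v}))"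
      unfolding un using card_UN_le[OF finU, of "\<lambda>(g, v). {g} \<times> {x \<in> V m. x \<subseteq> v}"]
      by (simp add: case_prod_unfold)
    then have "real (card ?U) \<le> real (\<Sum>(g, v)\<in>U. card ({g} \<times> {x \<in> V m. x \<subseteq> v}))"
      by (rule of_nat_mono)
    also have "\<dots> = (\<Sum>(g, v)\<in>U. real (card (V m)) / real (card (V n)))"
      unfolding of_nat_sum using U' fib by (intro sum.cong) (auto simp: card_cartesian_product_singleton)
    also have "\<dots> = real (card U) * (real (card (V m)) / real (card (V n)))" by simp
    finally show "real (card ?U) / real (card (V m)) \<le> real (card U) / real (card (V n))"
      using card_V_pos[of m] by (simp add: field_simps)
  qed
  also have "\<dots> = of_nat (card U) * ennreal (1 / real (card (V n)))"
    by (rule ennreal_of_nat_divide)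
  finally show "cost L m \<le> of_nat (card U) * ennreal (1 / real (card (V n)))" .
qed

lemma cost_tendsto: "(\<lambda>n. cost L n) \<longlonglongrightarrow> (INF n. cost L n)"
  by (rule LIMSEQ_INF) (simp add: decseq_def cost_antimono)

lemma action_cost_coset: "action_cost G (coset_measure G (H n)) act = (INF L. cost L n)"
  unfolding coset_measure_eq by (rule finite_action.action_cost_eq[OF finite_action_V])

lemma action_cost_tendsto: "(\<lambda>n. action_cost G (coset_measure G (H n)) act) \<longlonglongrightarrow> chain_cost"
proof -
  have "(\<lambda>n. INF L. cost L n) \<longlonglongrightarrow> (INF n. INF L. cost L n)"
    by (rule LIMSEQ_INF) (auto simp: decseq_def intro!: INF_mono cost_antimono)
  moreover have "(INF n. INF L. cost L n) = chain_cost"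
    unfolding chain_cost_def by (rule INF_commute)
  ultimately show ?thesis by (simp add: action_cost_coset)
qed

text \<open>A nonprincipal ultrafilter contains every tail, so a sequence that converges, here by
  monotonicity, has the same limit along it.\<close>

lemma ultra_combinatorial_cost_eq:
  assumes u: "nonprincipal_ultrafilter \<uu>"
  shows "ultra_combinatorial_cost \<uu> G S (\<lambda>n. coset_measure G (H n)) (\<lambda>n. act) = chain_cost"
proof -
  have "\<uu> \<le> sequentially"
    using nonprincipal_ultrafilter_eventually_ge[OF u] by (simp add: le_sequentially)
  then have "((\<lambda>n. cost L n) \<longlongrightarrow> (INF n. cost L n)) \<uu>" for L
    using cost_tendsto by (rule tendsto_mono)
  then have "Lim \<uu> (\<lambda>n. cost L n) = (INF n. cost L n)" for L
    using u by (intro tendsto_Lim) (auto simp: nonprincipal_ultrafilter_def)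
  then show ?thesis
    unfolding ultra_combinatorial_cost_def chain_cost_def coset_measure_eq
      finite_action.lipschitz_cost_eq[OF finite_action_V] by simp
qed

section \<open>The Farber condition and the cost of the Schreier graphs\<close>

text \<open>If \<open>g\<close> fixes the coset of \<open>h\<close>, then
  \<open>g \<otimes> h\<close> lies in that coset, so \<open>g\<close> lies in the conjugate of
  \<open>H n\<close> by \<open>h\<close>. Fixed cosets are therefore among those counted in the
  Farber condition.\<close>

lemma card_fixed_tendsto_0:
  assumes g: "g \<in> carrier G" "g \<noteq> \<one>"
  shows "(\<lambda>n. real (card {x \<in> V n. act g x = x}) / real (card (V n))) \<longlonglongrightarrow> 0"
proof (rule tendsto_sandwich[OF _ _ tendsto_const])
  let ?C = "\<lambda>n. {h <# H n |h. h \<in> carrier G \<and> g \<in> (h <# H n) #> inv h}"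
  show "(\<lambda>n. real (card (?C n)) / real (card (V n))) \<longlonglongrightarrow> 0"
    using farber g unfolding farber_sequence_def by blast
  have "{x \<in> V n. act g x = x} \<subseteq> ?C n" for n
  proof clarify
    fix x assume "x \<in> V n" and fixed: "act g x = x"
    then obtain h where h: "h \<in> carrier G" "x = h <# H n" by (auto simp: LCOSETS_def)
    have "h \<in> x" unfolding h(2) by (rule lcos_self[OF h(1) subgroup_H])
    then have "g \<otimes> h \<in> act g x" by (auto simp: coset_action_def l_coset_def)
    then have "g \<otimes> h \<in> h <# H n" unfolding fixed unfolding h(2) .
    moreover have "g = (g \<otimes> h) \<otimes> inv h" using g h by (simp add: m_assoc)
    ultimately have "g \<in> (h <# H n) #> inv h" by (auto simp: r_coset_def)
    with h show "\<exists>h. x = h <# H n \<and> h \<in> carrier G \<and> g \<in> (h <# H n) #> inv h" by blast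
  qed
  moreover have "finite (?C n)" for n
    by (rule finite_subset[OF _ finite_V[of n]]) (auto simp: LCOSETS_def)
  ultimately show "\<forall>\<^sub>F n in sequentially. real (card {x \<in> V n. act g x = x}) / real (card (V n))
      \<le> real (card (?C n)) / real (card (V n))"
    by (intro always_eventually allI divide_right_mono of_nat_mono card_mono) auto
qed simp

text \<open>The word ball is finite, so a union bound reduces the claim to one nontrivial element at
  a time. The expression is the error term of \<open>finite_cost_le\<close>.\<close>

lemma card_bad_tendsto_0:
  "(\<lambda>n. real (card S) * real (card {x \<in> V n. \<exists>g\<in>word_ball G S k - {\<one>}. act g x = x})
      / real (card (V n))) \<longlonglongrightarrow> 0"
proof (rule tendsto_sandwich[OF _ _ tendsto_const])
  let ?B = "word_ball G S k - {\<one>}"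
  have fin: "finite ?B" by (simp add: finite_word_ball finite_generators)
  have "(\<lambda>n. real (card S) * (\<Sum>g\<in>?B. real (card {x \<in> V n. act g x = x}) / real (card (V n))))
      \<longlonglongrightarrow> real (card S) * (\<Sum>g\<in>?B. 0)"
    using word_ball_closed[OF generators_closed, of k]
    by (intro tendsto_intros card_fixed_tendsto_0) auto
  then show "(\<lambda>n. real (card S) * (\<Sum>g\<in>?B. real (card {x \<in> V n. act g x = x}) / real (card (V n))))
      \<longlonglongrightarrow> 0" by simp
  have "card {x \<in> V n. \<exists>g\<in>?B. act g x = x} \<le> (\<Sum>g\<in>?B. card {x \<in> V n. act g x = x})" for n
  proof -
    have "{x \<in> V n. \<exists>g\<in>?B. act g x = x} = (\<Union>g\<in>?B. {x \<in> V n. act g x = x})" by auto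
    then show ?thesis using card_UN_le[OF fin] by metis
  qed
  then have "real (card {x \<in> V n. \<exists>g\<in>?B. act g x = x}) \<le> (\<Sum>g\<in>?B. real (card {x \<in> V n. act g x = x}))" for n
    unfolding of_nat_sum[symmetric] by (rule of_nat_mono)
  then show "\<forall>\<^sub>F n in sequentially. real (card S) * real (card {x \<in> V n. \<exists>g\<in>?B. act g x = x}) / real (card (V n))
      \<le> real (card S) * (\<Sum>g\<in>?B. real (card {x \<in> V n. act g x = x}) / real (card (V n)))"
    unfolding sum_divide_distrib[symmetric] times_divide_eq_right
    by (intro always_eventually allI divide_right_mono mult_left_mono) auto
qed simp

lemma schreier_edges_eq: "schreier_edges G (H n) S = arrow_edges act (S \<times> V n)"
  unfolding schreier_edges_def arrow_edges_def by force

text \<open>The graph costs are squeezed: \<open>cost L n\<close> bounds them from above, and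
  \<open>chain_cost\<close> minus an error bounds them from below. The radius of the ball behind the
  error depends on L alone, so for fixed L the error vanishes as n grows, and a bound on the liminf
  suffices.\<close>

lemma combinatorial_cost_eq:
  "combinatorial_cost V (\<lambda>n. schreier_edges G (H n) S) = chain_cost"
proof (rule antisym)
  let ?h = "\<lambda>L n. graph_lipschitz_cost L (V n) (schreier_edges G (H n) S)"
  have "liminf (?h L) \<le> (INF n. cost L n)" for L
  proof -
    have "liminf (?h L) \<le> liminf (\<lambda>n. cost L n)"
      unfolding schreier_edges_eq
      by (intro Liminf_mono always_eventually allI finite_action.graph_lipschitz_cost_le finite_action_V)
    also have "\<dots> = (INF n. cost L n)"
      by (rule lim_imp_Liminf[OF _ cost_tendsto]) simp
    finally show ?thesis .
  qed
  then show "combinatorial_cost V (\<lambda>n. schreier_edges G (H n) S) \<le> chain_cost"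
    unfolding combinatorial_cost_def chain_cost_def by (intro INF_mono) auto
  have "chain_cost \<le> liminf (?h L)" for L
  proof (rule ennreal_le_epsilon)
    fix e :: real assume e: "0 < e"
    let ?b = "\<lambda>n. real (card S) * real (card {x \<in> V n. \<exists>g\<in>word_ball G S (Suc (L * L)) - {\<one>}. act g x = x})
      / real (card (V n))"
    have "\<forall>\<^sub>F n in sequentially. ?b n < e"
      using card_bad_tendsto_0 e by (rule order_tendstoD)
    then have "\<forall>\<^sub>F n in sequentially. chain_cost - ennreal e \<le> ?h L n"
    proof eventually_elim
      case (elim n)
      have "chain_cost \<le> cost (max L 1) n"
        unfolding chain_cost_def by (intro INF_lower2[of "max L 1"] INF_lower) auto
      also have "\<dots> \<le> ?h L n + ennreal (?b n)"
        unfolding schreier_edges_eq by (rule finite_action.finite_cost_le[OF finite_action_V])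
      also have "\<dots> \<le> ?h L n + ennreal e"
        using elim by (intro add_left_mono ennreal_leI) auto
      finally show ?case by (simp add: ennreal_minus_le_iff add.commute)
    qed
    then have "chain_cost - ennreal e \<le> liminf (?h L)" by (rule Liminf_bounded)
    then show "chain_cost \<le> liminf (?h L) + ennreal e" by (simp add: ennreal_minus_le_iff add.commute)
  qed
  then show "chain_cost \<le> combinatorial_cost V (\<lambda>n. schreier_edges G (H n) S)"
    unfolding combinatorial_cost_def by (intro INF_greatest)
qed

end

section \<open>The ultraproduct action\<close>

locale ultra_chain = farber_chain G S H
  for G :: "('g, 'b) monoid_scheme" (structure) and S and H +
  fixes \<uu> :: "nat filter"
  assumes ultrafilter: "nonprincipal_ultrafilter \<uu>"
begin

abbreviation "M n \<equiv> coset_measure G (H n)"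
abbreviation "Mu \<equiv> loeb_measure \<uu> M"
abbreviation "uact \<equiv> ultraproduct_action \<uu> M (\<lambda>n. act)"
abbreviation "seqs \<equiv> Pi UNIV (\<lambda>n. space (M n))"
abbreviation "cls x \<equiv> ultra_rel \<uu> (\<lambda>n. space (M n)) `` {x}"

lemma prob_M: "prob_space (M n)"
  by (rule prob_space_coset_measure[OF group_axioms finite_V])

sublocale loeb: loeb_space \<uu> M
  by (intro loeb_space.intro ultrafilter prob_M)

lemma space_M: "space (M n) = V n" and sets_M: "sets (M n) = Pow (V n)"
  by (simp_all add: coset_measure_eq space_uniform_count_measure sets_uniform_count_measure)

lemma emeasure_M: "A \<subseteq> V n \<Longrightarrow> emeasure (M n) A = of_nat (card A) * ennreal (1 / real (card (V n)))"
  unfolding coset_measure_eq ennreal_of_nat_divide[symmetric]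
  by (rule emeasure_uniform_count_measure[OF finite_V])

lemma msets_iff: "A \<in> loeb.msets \<longleftrightarrow> (\<forall>n. A n \<subseteq> V n)"
  by (simp add: loeb.msets_def sets_M)

lemma seqs_iff: "x \<in> seqs \<longleftrightarrow> (\<forall>n. x n \<in> V n)"
  by (simp add: Pi_iff space_M)

text \<open>A finite union belongs to an ultrafilter only if one of its members does. This singles
  out the coset in \<open>V n\<close> over which a point of the ultraproduct lies.\<close>

lemma eventually_finite_choice:
  assumes "finite A" and "\<forall>\<^sub>F n in \<uu>. \<exists>v\<in>A. P v n"
  shows "\<exists>v\<in>A. \<forall>\<^sub>F n in \<uu>. P v n"
proof (rule ccontr)
  assume "\<not> ?thesis"
  then have "\<forall>v\<in>A. \<forall>\<^sub>F n in \<uu>. \<not> P v n" by (simp add: loeb.eventually_not_iff)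
  then have "\<forall>\<^sub>F n in \<uu>. \<forall>v\<in>A. \<not> P v n" by (rule eventually_ball_finite[OF assms(1)])
  with assms(2) have "\<forall>\<^sub>F n in \<uu>. False" by eventually_elim auto
  with loeb.nb show False by (simp add: eventually_False)
qed

lemma act_seqs: "g \<in> carrier G \<Longrightarrow> x \<in> seqs \<Longrightarrow> (\<lambda>n. act g (x n)) \<in> seqs"
  unfolding seqs_iff using set_action.act_closed[OF set_action_coset[OF subgroup_H]] by blast

lemma cls_in_X: "x \<in> seqs \<Longrightarrow> cls x \<in> loeb.X"
  unfolding ultraproduct_def by (rule quotientI)

lemma cls_eqI: "x \<in> seqs \<Longrightarrow> y \<in> seqs \<Longrightarrow> \<forall>\<^sub>F n in \<uu>. x n = y n \<Longrightarrow> cls x = cls y"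
  unfolding ultra_rel_def by (auto elim: eventually_elim2)

lemma uact_cls:
  assumes g: "g \<in> carrier G" and x: "x \<in> seqs"
  shows "uact g (cls x) = cls (\<lambda>n. act g (x n))"
proof -
  have "cls (\<lambda>n. act g (y n)) = cls (\<lambda>n. act g (x n))" if "y \<in> cls x" for y
  proof (rule cls_eqI)
    show "\<forall>\<^sub>F n in \<uu>. act g (y n) = act g (x n)"
      using that by (auto simp: ultra_rel_def elim: eventually_mono)
  qed (use that x act_seqs[OF g] in \<open>auto simp: ultra_rel_def\<close>)
  moreover have "x \<in> cls x" using x by (simp add: ultra_rel_def)
  ultimately show ?thesis unfolding ultraproduct_action_def by blast
qed

lemma set_action_uact: "set_action G loeb.X uact"
proof
  fix g c assume g: "g \<in> carrier G" and "c \<in> loeb.X"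
  then obtain x where "x \<in> seqs" "c = cls x" by (elim loeb.quotE)
  then show "uact g c \<in> loeb.X" using g by (simp add: uact_cls cls_in_X act_seqs)
next
  fix c assume "c \<in> loeb.X"
  then obtain x where x: "x \<in> seqs" "c = cls x" by (elim loeb.quotE)
  have "act \<one> (x n) = x n" for n
    using x(1) by (intro set_action.act_one[OF set_action_coset[OF subgroup_H[of n]]]) (simp add: seqs_iff)
  then show "uact \<one> c = c" using x by (simp add: uact_cls)
next
  fix g h c assume gh: "g \<in> carrier G" "h \<in> carrier G" and "c \<in> loeb.X"
  then obtain x where x: "x \<in> seqs" "c = cls x" by (elim loeb.quotE)
  have "act (g \<otimes> h) (x n) = act g (act h (x n))" for n
    using x(1) gh
    by (intro set_action.act_mult[OF set_action_coset[OF subgroup_H[of n]]]) (simp_all add: seqs_iff)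
  then show "uact (g \<otimes> h) c = uact g (uact h c)" using x gh by (simp add: uact_cls act_seqs)
qed

lemma generated_action_uact: "generated_action G S (space Mu) uact"
  unfolding loeb.space_loeb by (intro generated_action.intro generated_group_axioms set_action_uact)

interpretation uact: generated_action G S loeb.X uact
  using generated_action_uact by (simp only: loeb.space_loeb)

interpretation Mu: prob_space Mu
  by (rule loeb.prob_space_loeb)

text \<open>
  A point of the ultraproduct lies over the coset of \<open>H n\<close> that contains almost all of its
  terms; this factor map onto \<open>V n\<close> exists because the sequence is nested.
\<close>

lemma action_cost_uact_le: "action_cost G Mu uact \<le> cost L n"
proof -
  define B where "B v m = {x \<in> V m. x \<subseteq> v}" for v m
  have B: "B v \<in> loeb.msets" for v by (auto simp: msets_iff B_def)
  have fiber: "{c \<in> space Mu. c \<in> loeb.I (B v)} = loeb.I (B v)" for v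
    using loeb.I_sub by (auto simp: loeb.space_loeb)
  show ?thesis
  proof (rule action_cost_le_finite_cost[where R = "\<lambda>c v. c \<in> loeb.I (B v)"])
    show "sigma_finite_measure Mu" by (rule Mu.sigma_finite_measure_axioms)
    show "generated_action G S (space Mu) uact" by (rule generated_action_uact)
    show "generated_action G S (V n) act" by (rule generated_action_V)
  next
    fix g c v assume g: "g \<in> carrier G" and "c \<in> space Mu" and c: "c \<in> loeb.I (B v)"
    then obtain x where x: "x \<in> seqs" "c = cls x" unfolding loeb.space_loeb by (elim loeb.quotE)
    have "\<forall>\<^sub>F m in \<uu>. x m \<in> B v m" using c x by (simp add: loeb.internal_class)
    then have "\<forall>\<^sub>F m in \<uu>. act g (x m) \<in> B (act g v) m"
    proof (rule eventually_mono)
      fix m assume "x m \<in> B v m"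
      moreover have "act g (x m) \<in> V m" using act_seqs[OF g x(1)] by (simp add: seqs_iff)
      ultimately show "act g (x m) \<in> B (act g v) m"
        using coset_action_mono[of "x m" v g] by (simp add: B_def)
    qed
    then show "uact g c \<in> loeb.I (B (act g v))"
      using x g act_seqs[OF g x(1)] by (simp add: uact_cls loeb.internal_class)
  next
    fix c assume "c \<in> space Mu"
    then obtain x where x: "x \<in> seqs" "c = cls x" unfolding loeb.space_loeb by (elim loeb.quotE)
    have "\<forall>\<^sub>F m in \<uu>. n \<le> m" by (rule nonprincipal_ultrafilter_eventually_ge[OF ultrafilter])
    \<comment> \<open>For an index m below n the coset \<open>x m\<close> need not lie inside a
      coset of \<open>H n\<close>; the ultrafilter ignores these finitely many indices.\<close>
    then have "\<forall>\<^sub>F m in \<uu>. \<exists>v\<in>V n. x m \<in> B v m"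
    proof (rule eventually_mono)
      fix m assume "n \<le> m"
      moreover have "x m \<in> V m" using x(1) by (simp add: seqs_iff)
      ultimately show "\<exists>v\<in>V n. x m \<in> B v m"
        using lcoset_sub_ex[OF H_antimono] unfolding B_def by blast
    qed
    then have "\<exists>v\<in>V n. \<forall>\<^sub>F m in \<uu>. x m \<in> B v m"
      by (rule eventually_finite_choice[OF finite_V])
    then show "\<exists>v\<in>V n. c \<in> loeb.I (B v)"
      using x by (simp add: loeb.internal_class)
  next
    fix v assume v: "v \<in> V n"
    show "{c \<in> space Mu. c \<in> loeb.I (B v)} \<in> sets Mu"
      unfolding fiber loeb.sets_loeb by (rule loeb.internal_loeb[OF B])
    \<comment> \<open>From index n on, the fibre over \<open>v\<close> has a constant proportion, so
      the limit is attained exactly.\<close>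
    have "loeb.m (B v) = ennreal (1 / real (card (V n)))"
    proof (rule loeb.mI, rule tendsto_eventually)
      have "\<forall>\<^sub>F m in \<uu>. n \<le> m" by (rule nonprincipal_ultrafilter_eventually_ge[OF ultrafilter])
      then show "\<forall>\<^sub>F m in \<uu>. emeasure (M m) (B v m) = ennreal (1 / real (card (V n)))"
        by (rule eventually_mono) (simp add: B_def emeasure_fiber v)
    qed
    then show "emeasure Mu {c \<in> space Mu. c \<in> loeb.I (B v)} = ennreal (1 / real (card (V n)))"
      unfolding fiber loeb.emeasure_loeb_internal[OF B] .
  qed
qed

section \<open>Lower bound for the cost of the ultraproduct action\<close>

text \<open>Translation by \<open>g\<close> is injective on each \<open>V n\<close>, so preimages of
  internal sets gain no mass. The purpose is that translates of null sets are null, which allows an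
  exceptional set to be made invariant.\<close>

lemma out_preimage_le:
  assumes g: "g \<in> carrier G"
  shows "loeb.out {c \<in> loeb.X. uact g c \<in> B} \<le> loeb.out B"
  unfolding loeb.outer_def[of B]
proof (rule INF_greatest, clarify)
  fix A assume A: "A \<in> loeb.msets" "B \<subseteq> loeb.I A"
  let ?A = "\<lambda>n. {x \<in> V n. act g x \<in> A n}"
  have "{c \<in> loeb.X. uact g c \<in> B} \<subseteq> loeb.I ?A"
  proof clarify
    fix c assume c: "c \<in> loeb.X" "uact g c \<in> B"
    then obtain x where x: "x \<in> seqs" "c = cls x" by (elim loeb.quotE)
    have "cls (\<lambda>n. act g (x n)) \<in> loeb.I A" using c(2) A(2) x g by (auto simp: uact_cls)
    then have "\<forall>\<^sub>F n in \<uu>. act g (x n) \<in> A n"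
      using act_seqs[OF g x(1)] by (simp add: loeb.internal_class)
    then show "c \<in> loeb.I ?A" using x by (simp add: loeb.internal_class seqs_iff)
  qed
  then have "loeb.out {c \<in> loeb.X. uact g c \<in> B} \<le> loeb.m ?A"
    unfolding loeb.outer_def by (intro INF_lower) (auto simp: msets_iff)
  also have "\<dots> \<le> loeb.m A"
  proof (rule tendsto_le[OF loeb.nb loeb.m_tendsto loeb.m_tendsto], rule always_eventually, rule allI)
    fix n
    interpret set_action G "V n" act by (rule set_action_coset[OF subgroup_H])
    have "A n \<subseteq> V n" using A(1) by (simp add: msets_iff)
    then have "card (?A n) \<le> card (A n)"
      using act_inj[OF g] finite_V[of n]
      by (intro card_inj_on_le[of "act g"] inj_onI) (auto dest: finite_subset)
    then show "emeasure (M n) (?A n) \<le> emeasure (M n) (A n)"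
      using \<open>A n \<subseteq> V n\<close> by (auto simp: emeasure_M intro!: mult_right_mono of_nat_mono)
  qed
  finally show "loeb.out {c \<in> loeb.X. uact g c \<in> B} \<le> loeb.m A" .
qed

lemma null_in_null_sets:
  assumes "N \<subseteq> loeb.X" "loeb.out N = 0"
  shows "N \<in> null_sets Mu"
proof -
  have "N \<in> loeb_sets \<uu> M"
    using assms loeb.msets_empty by (auto simp: loeb.loeb_sets_eq loeb.I_empty intro!: bexI[of _ "\<lambda>n. {}"])
  then show ?thesis using assms(2) by (intro null_setsI) (simp_all add: loeb.emeasure_loeb loeb.sets_loeb)
qed

text \<open>Membership in an internal set passes to almost every index, and a word combines finitely
  many such memberships. The length is fixed before the index, since only finitely many conditions
  can be intersected in the ultrafilter.\<close>

lemma words_internal: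
  assumes A: "\<And>g. A g \<in> loeb.msets" and x: "x \<in> seqs"
    and "(g, cls x) \<in> words G loeb.X uact {(g, c). g \<in> word_ball G S K \<and> c \<in> loeb.I (A g)} k"
  shows "\<forall>\<^sub>F n in \<uu>. (g, x n) \<in> words G (V n) act {(g, y). g \<in> word_ball G S K \<and> y \<in> A g n} k"
  using assms(3)
proof (induction k arbitrary: g)
  case 0
  then show ?case using x by (simp add: seqs_iff)
next
  case (Suc k)
  let ?U = "{(g, c). g \<in> word_ball G S K \<and> c \<in> loeb.I (A g)}"
  let ?W = "\<lambda>n. {(g, y). g \<in> word_ball G S K \<and> y \<in> A g n}"
  have U: "?U \<subseteq> carrier G \<times> loeb.X"
    using word_ball_closed[OF generators_closed] loeb.I_sub by blast
  have W: "?W n \<subseteq> carrier G \<times> V n" for n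
    using word_ball_closed[OF generators_closed] A unfolding msets_iff by blast
  show ?case
  proof (cases "(g, cls x) \<in> words G loeb.X uact ?U k")
    case True
    from Suc.IH[OF this] show ?thesis by (rule eventually_mono) simp
  next
    case False
    then obtain d h where d: "(h, cls x) \<in> words G loeb.X uact ?U k"
      "(d, uact h (cls x)) \<in> sym_arrows G uact ?U" "g = d \<otimes> h"
      using Suc.prems by auto
    have c: "d \<in> carrier G" "h \<in> carrier G"
      using d uact.words_closed[OF U] uact.sym_arrows_closed[OF U] by auto
    note hx = act_seqs[OF c(2) x]
    note dhx = act_seqs[OF c(1) hx]
    have "\<forall>\<^sub>F n in \<uu>. (d, act h (x n)) \<in> sym_arrows G act (?W n)"
    proof -
      from d(2) consider "d \<in> word_ball G S K" "uact h (cls x) \<in> loeb.I (A d)"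
        | "inv d \<in> word_ball G S K" "uact d (uact h (cls x)) \<in> loeb.I (A (inv d))"
        unfolding uact.sym_arrows_iff[OF U] by auto
      then show ?thesis
      proof cases
        case 1
        then have "\<forall>\<^sub>F n in \<uu>. act h (x n) \<in> A d n"
          using x c hx by (simp add: uact_cls loeb.internal_class)
        then show ?thesis by (rule eventually_mono) (use 1 in \<open>simp add: sym_arrows_def\<close>)
      next
        case 2
        then have "\<forall>\<^sub>F n in \<uu>. act d (act h (x n)) \<in> A (inv d) n"
          using x c hx dhx by (simp add: uact_cls loeb.internal_class)
        then show ?thesis
        proof (rule eventually_mono)
          fix n assume "act d (act h (x n)) \<in> A (inv d) n"
          moreover have "act h (x n) \<in> V n" using hx by (simp add: seqs_iff)
          ultimately show "(d, act h (x n)) \<in> sym_arrows G act (?W n)"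
            using 2 c set_action.sym_arrows_iff[OF set_action_coset[OF subgroup_H] W] by simp
        qed
      qed
    qed
    with Suc.IH[OF d(1)] show ?thesis
      by eventually_elim (use d(3) in auto)
  qed
qed

text \<open>The sets \<open>E K n\<close> grow with K. Almost every point of the ultraproduct lies
  in the internal set given by some \<open>E K\<close>, because its words can be truncated and
  transferred to almost every index; continuity from above of the Loeb measure then gives the
  limit.\<close>

lemma generating_truncation:
  fixes I :: "nat set"
  assumes gr: "graphing (action_groupoid G Mu uact) I \<phi>"
    and gen: "generating (action_groupoid G Mu uact) I \<phi>"
    and A: "\<And>g. A g \<in> loeb.msets"
    and A_eq: "\<And>g. loeb.out (sym_diff {c \<in> loeb.X. (g, c) \<in> (\<Union>i\<in>I. \<phi> i)} (loeb.I (A g))) = 0"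
  defines "E \<equiv> \<lambda>K n. {x \<in> V n. \<forall>s\<in>S. (s, x) \<in> words G (V n) act {(g, y). g \<in> word_ball G S K \<and> y \<in> A g n} K}"
  shows "(\<lambda>K. loeb.m (\<lambda>n. V n - E K n)) \<longlonglongrightarrow> 0"
proof -
  let ?U = "\<Union>i\<in>I. \<phi> i"
  have U: "?U \<subseteq> carrier G \<times> loeb.X"
    using graphing_sub_space[OF gr] by (simp add: loeb.space_loeb)
  define N where "N g = sym_diff {c \<in> loeb.X. (g, c) \<in> ?U} (loeb.I (A g))" for g
  \<comment> \<open>These are the points whose orbit meets some \<open>N d\<close>. The set is still
    null because the group is countable, and it is invariant, so a word that starts outside never
    enters it.\<close>
  define N' where "N' = {c \<in> loeb.X. \<exists>(g, d)\<in>carrier G \<times> carrier G. uact g c \<in> N d}"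
  have N'_out: "loeb.out N' = 0"
  proof -
    let ?C = "carrier G \<times> carrier G"
    let ?P = "\<lambda>(g, d). {c \<in> loeb.X. uact g c \<in> N d}"
    have C: "countable ?C" "?C \<noteq> {}" using countable_carrier by auto
    have P0: "loeb.out (?P e) = 0" if "e \<in> ?C" for e
    proof -
      obtain g d where e: "e = (g, d)" "g \<in> carrier G" using \<open>e \<in> ?C\<close> by auto
      have "loeb.out (?P e) \<le> loeb.out (N d)"
        unfolding e prod.case by (rule out_preimage_le[OF e(2)])
      then show ?thesis using A_eq[of d] by (simp add: N_def)
    qed
    have "N' \<subseteq> (\<Union>i. ?P (from_nat_into ?C i))"
    proof
      fix c assume "c \<in> N'"
      then obtain e where e: "e \<in> ?C" "c \<in> ?P e" by (auto simp: N'_def)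
      obtain i where "from_nat_into ?C i = e" using from_nat_into_surj[OF C(1) e(1)] ..
      then have "c \<in> ?P (from_nat_into ?C i)" using e(2) by (simp only:)
      then show "c \<in> (\<Union>i. ?P (from_nat_into ?C i))" by (rule UN_I[OF UNIV_I])
    qed
    moreover have "loeb.out (\<Union>i. ?P (from_nat_into ?C i)) = 0"
      by (rule loeb.null_UN) (rule P0, rule from_nat_into[OF C(2)])
    ultimately show ?thesis by (rule loeb.null_sub)
  qed
  have "N' \<in> null_sets Mu" by (rule null_in_null_sets[OF _ N'_out]) (auto simp: N'_def)
  then have ae_N': "AE c in Mu. c \<notin> N'" by (rule AE_not_in)
  let ?V = "{(g, c). g \<in> carrier G \<and> c \<in> loeb.I (A g)}"
  have V: "?V \<subseteq> carrier G \<times> loeb.X" using loeb.I_sub by auto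
  have N'_inv: "c \<in> N'" if h: "h \<in> carrier G" "c \<in> loeb.X" and N': "uact h c \<in> N'" for h c
  proof -
    obtain g d where "g \<in> carrier G" "d \<in> carrier G" "uact g (uact h c) \<in> N d"
      using N' by (auto simp: N'_def)
    then have "g \<otimes> h \<in> carrier G" "d \<in> carrier G" "uact (g \<otimes> h) c \<in> N d"
      using h by (simp_all add: uact.act_mult)
    with h(2) show ?thesis unfolding N'_def by blast
  qed
  have UV: "(g, c) \<in> ?V" if "c \<notin> N'" "(g, c) \<in> ?U" for g c
  proof -
    have gc: "g \<in> carrier G" "c \<in> loeb.X" using that(2) U by auto
    \<comment> \<open>The identity as translating element shows that \<open>N'\<close> contains
      \<open>N g\<close>.\<close>
    have "uact \<one> c \<notin> N g" using that(1) gc unfolding N'_def by blast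
    then have "c \<notin> N g" using gc by (simp add: uact.act_one)
    then show ?thesis using that(2) gc unfolding N_def by blast
  qed
  have E_mono: "E K n \<subseteq> E K' n" if "K \<le> K'" for K K' n
  proof -
    have "{(g, y). g \<in> word_ball G S K \<and> y \<in> A g n} \<subseteq> {(g, y). g \<in> word_ball G S K' \<and> y \<in> A g n}"
      using word_ball_mono[OF that, of G S] by blast
    from words_mono[OF this that] show ?thesis unfolding E_def by blast
  qed
  have Em: "E K \<in> loeb.msets" for K by (auto simp: msets_iff E_def)
  have gen': "AE c in Mu. \<forall>s\<in>S. (s, c) \<in> (\<Union>k. words G loeb.X uact ?U k)"
  proof (rule AE_finite_allI[OF finite_generators])
    fix s assume "s \<in> S"
    then have s: "s \<in> carrier G" using generators_closed by auto
    have "AE e in count_space (carrier G) \<Otimes>\<^sub>M Mu. e \<in> (\<Union>k. words G loeb.X uact ?U k)"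
      using gen generated_subgroupoid_eq_words[of G Mu uact ?U] set_action_uact U
      by (simp only: generating_def loeb.space_loeb action_groupoid_sel)
    then show "AE c in Mu. (s, c) \<in> (\<Union>k. words G loeb.X uact ?U k)"
      using s by (rule Mu.AE_slice)
  qed
  have in_E: "AE c in Mu. \<exists>K. c \<in> loeb.I (E K)"
    using ae_N' gen' AE_space
  proof eventually_elim
    case (elim c)
    then obtain x where x: "x \<in> seqs" "c = cls x" unfolding loeb.space_loeb by (elim loeb.quotE)
    have "\<forall>s\<in>S. \<exists>K. \<forall>\<^sub>F n in \<uu>.
      (s, x n) \<in> words G (V n) act {(g, y). g \<in> word_ball G S K \<and> y \<in> A g n} K"
    proof
      fix s assume s: "s \<in> S"
      obtain k where k: "(s, c) \<in> words G loeb.X uact ?U k" using elim(2) s by blast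
      have "(s, c) \<in> words G loeb.X uact ?V k"
        by (rule uact.words_avoid[where N = N', OF U V _ _ elim(1) k]) (fact N'_inv UV)+
      then obtain K where K: "(s, c) \<in> words G loeb.X uact (?V \<inter> word_ball G S K \<times> loeb.X) K"
        using uact.words_truncate[OF generators_closed generate_eq V] by blast
      have "?V \<inter> word_ball G S K \<times> loeb.X = {(g, c). g \<in> word_ball G S K \<and> c \<in> loeb.I (A g)}"
        using word_ball_closed[OF generators_closed] loeb.I_sub by blast
      then show "\<exists>K. \<forall>\<^sub>F n in \<uu>.
        (s, x n) \<in> words G (V n) act {(g, y). g \<in> word_ball G S K \<and> y \<in> A g n} K"
        using words_internal[where A = A and g = s and K = K and k = K, OF A x(1)] K x(2)
        by (auto simp only:)
    qed
    from bchoice[OF this] obtain f where f: "\<forall>s\<in>S. \<forall>\<^sub>F n in \<uu>.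
      (s, x n) \<in> words G (V n) act {(g, y). g \<in> word_ball G S (f s) \<and> y \<in> A g n} (f s)" ..
    \<comment> \<open>There are finitely many generators, so one K and one set of indices in the
      ultrafilter serve them all.\<close>
    define K where "K = Max (insert 0 (f ` S))"
    have "\<forall>\<^sub>F n in \<uu>. \<forall>s\<in>S. (s, x n) \<in> words G (V n) act {(g, y). g \<in> word_ball G S K \<and> y \<in> A g n} K"
    proof (rule eventually_ball_finite[OF finite_generators], rule ballI)
      fix s assume s: "s \<in> S"
      have le: "f s \<le> K" unfolding K_def using finite_generators s by (intro Max_ge) auto
      have "{(g, y). g \<in> word_ball G S (f s) \<and> y \<in> A g n} \<subseteq> {(g, y). g \<in> word_ball G S K \<and> y \<in> A g n}" for n
        using word_ball_mono[OF le, of G S] by blast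
      note mono = words_mono[OF this le]
      show "\<forall>\<^sub>F n in \<uu>. (s, x n) \<in> words G (V n) act {(g, y). g \<in> word_ball G S K \<and> y \<in> A g n} K"
        using bspec[OF f s] by (rule eventually_mono) (rule subsetD[OF mono])
    qed
    then have "\<forall>\<^sub>F n in \<uu>. x n \<in> E K n"
      by (rule eventually_mono) (use x(1) in \<open>simp add: E_def seqs_iff\<close>)
    then show ?case using x by (auto simp: loeb.internal_class)
  qed
  define B where "B K = loeb.I (\<lambda>n. V n - E K n)" for K
  have Bm: "(\<lambda>n. V n - E K n) \<in> loeb.msets" for K by (auto simp: msets_iff)
  have B_eq: "B K = loeb.X - loeb.I (E K)" for K
    using loeb.I_Diff[of "\<lambda>n. V n" "E K"] loeb.I_space by (simp add: B_def space_M)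
  \<comment> \<open>Here the value of K depending on the point is turned into one K outside a set of
    small measure.\<close>
  have "(\<lambda>K. emeasure Mu (B K)) \<longlonglongrightarrow> emeasure Mu (\<Inter>K. B K)"
  proof (rule Lim_emeasure_decseq)
    show "range B \<subseteq> sets Mu" using loeb.internal_loeb[OF Bm] by (auto simp: B_def loeb.sets_loeb)
    show "decseq B" unfolding decseq_def B_def using E_mono
      by (auto intro!: loeb.I_mono always_eventually)
  qed simp
  moreover have "(\<Inter>K. B K) \<in> null_sets Mu"
  proof (subst AE_iff_null_sets)
    have "B K \<in> sets Mu" for K
      unfolding B_def loeb.sets_loeb by (rule loeb.internal_loeb[OF Bm])
    then show "(\<Inter>K. B K) \<in> sets Mu" by auto
    show "AE c in Mu. c \<notin> (\<Inter>K. B K)" using in_E by eventually_elim (auto simp: B_eq)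
  qed
  moreover have "emeasure Mu (B K) = loeb.m (\<lambda>n. V n - E K n)" for K
    unfolding B_def by (rule loeb.emeasure_loeb_internal[OF Bm])
  ultimately show ?thesis by (simp add: null_setsD1)
qed

text \<open>Slices over distinct group elements are disjoint pieces of the union of the graphing, so
  their masses add up to at most its measure.\<close>

lemma sum_slices_le_graphing_cost:
  fixes I :: "nat set"
  assumes gr: "graphing (action_groupoid G Mu uact) I \<phi>" and F: "finite F" "F \<subseteq> carrier G"
  shows "(\<Sum>g\<in>F. emeasure Mu {c \<in> loeb.X. (g, c) \<in> (\<Union>i\<in>I. \<phi> i)}) \<le> graphing_cost (action_groupoid G Mu uact) I \<phi>"
proof -
  let ?P = "count_space (carrier G) \<Otimes>\<^sub>M Mu"
  let ?U = "\<Union>i\<in>I. \<phi> i"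
  have U: "?U \<in> sets ?P"
    using gr by (intro sets.countable_UN') (auto simp: graphing_def bisection_def)
  let ?B = "\<lambda>g. {c \<in> loeb.X. (g, c) \<in> ?U}"
  have B: "?B g \<in> sets Mu" for g
    using sets_slice[OF U, of g] by (simp only: loeb.space_loeb)
  have gB: "{g} \<times> ?B g \<in> sets ?P" if "g \<in> F" for g
    using that F by (intro sets_singleton_times B) auto
  have "(\<Sum>g\<in>F. emeasure Mu (?B g)) = (\<Sum>g\<in>F. emeasure ?P ({g} \<times> ?B g))"
    using F by (intro sum.cong refl Mu.emeasure_singleton_times[symmetric] B) auto
  also have "\<dots> = emeasure ?P (\<Union>g\<in>F. {g} \<times> ?B g)"
    using gB F by (intro sum_emeasure) (auto simp: disjoint_family_on_def)
  also have "\<dots> \<le> emeasure ?P ?U"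
    by (rule emeasure_mono[OF _ U]) auto
  also have "\<dots> \<le> graphing_cost (action_groupoid G Mu uact) I \<phi>"
    using emeasure_UN_le_graphing_cost[OF gr] by simp
  finally show ?thesis .
qed

text \<open>At every index n the letters read from \<open>A\<close>, completed by all generators
  outside \<open>E K n\<close>, form an admissible set with constant \<open>max K 1\<close>. Since
  \<open>chain_cost\<close> is an infimum over L and n, each n yields a bound, and these bounds pass
  to the ultrafilter limit.\<close>

lemma chain_cost_le_truncation:
  assumes A: "\<And>g. A g \<in> loeb.msets"
  defines "E \<equiv> \<lambda>K n. {x \<in> V n. \<forall>s\<in>S. (s, x) \<in> words G (V n) act {(g, y). g \<in> word_ball G S K \<and> y \<in> A g n} K}"
  shows "chain_cost \<le> (\<Sum>g\<in>word_ball G S K. loeb.m (A g)) + of_nat (card S) * loeb.m (\<lambda>n. V n - E K n)"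
proof (rule tendsto_lowerbound[OF _ _ loeb.nb])
  let ?f = "\<lambda>n. (\<Sum>g\<in>word_ball G S K. emeasure (M n) (A g n)) + of_nat (card S) * emeasure (M n) (V n - E K n)"
  show "(?f \<longlongrightarrow> (\<Sum>g\<in>word_ball G S K. loeb.m (A g)) + of_nat (card S) * loeb.m (\<lambda>n. V n - E K n)) \<uu>"
    by (intro tendsto_add tendsto_sum loeb.m_tendsto ennreal_tendsto_cmult) (simp add: of_nat_less_top)
  have "chain_cost \<le> ?f n" for n
  proof -
    interpret generated_action G S "V n" act by (rule generated_action_V)
    let ?B = "{(g, y). g \<in> word_ball G S K \<and> y \<in> A g n}"
    let ?L = "max K 1"
    define W where "W = ?B \<union> S \<times> (V n - E K n)"
    have An: "A g n \<subseteq> V n" for g using A by (simp add: msets_iff)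
    have fin_A: "finite (A g n)" for g by (rule finite_subset[OF An finite_V])
    have B_un: "?B = Sigma (word_ball G S K) (\<lambda>g. A g n)" by auto
    have finW: "finite W"
      unfolding W_def B_un by (auto intro: finite_word_ball finite_generators fin_A finite_V)
    have "?B \<subseteq> words G (V n) act (S \<times> V n) ?L"
      using An word_ball_mono[of K ?L G S] unfolding words_generators[OF generators_closed] by auto
    moreover have "S \<times> V n \<subseteq> words G (V n) act (S \<times> V n) ?L"
      using generators_closed by (intro subset_words) auto
    ultimately have W_sub: "W \<subseteq> words G (V n) act (S \<times> V n) ?L"
      unfolding W_def by blast
    then have W_closed: "W \<subseteq> carrier G \<times> V n"
      unfolding words_generators[OF generators_closed]
      using word_ball_closed[OF generators_closed, of ?L] by blast
    have "(s, x) \<in> words G (V n) act W ?L" if "s \<in> S" "x \<in> V n" for s x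
    proof (cases "x \<in> E K n")
      case True
      then have "(s, x) \<in> words G (V n) act ?B K" using that by (simp add: E_def)
      moreover have "words G (V n) act ?B K \<subseteq> words G (V n) act W ?L"
        by (rule words_mono) (auto simp: W_def)
      ultimately show ?thesis by blast
    next
      case False
      then have "(s, x) \<in> W" using that by (simp add: W_def)
      then show ?thesis using subset_words[OF W_closed, of ?L] by auto
    qed
    with finW W_sub have "admissible G S (V n) act ?L W" by (auto simp: admissible_def)
    then have cost_W: "cost ?L n \<le> of_nat (card W) * ennreal (1 / real (card (V n)))"
      unfolding finite_cost_def by (intro INF_lower) auto
    have card_W: "card W \<le> (\<Sum>g\<in>word_ball G S K. card (A g n)) + card S * card (V n - E K n)"
    proof -
      have "card W \<le> card ?B + card (S \<times> (V n - E K n))"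
        unfolding W_def by (rule card_Un_le)
      then show ?thesis
        unfolding B_un by (simp add: card_SigmaI finite_word_ball finite_generators fin_A card_cartesian_product)
    qed
    have "chain_cost \<le> cost ?L n"
      unfolding chain_cost_def by (intro INF_lower2[of ?L] INF_lower) auto
    also note cost_W
    also have "of_nat (card W) * ennreal (1 / real (card (V n)))
      \<le> of_nat ((\<Sum>g\<in>word_ball G S K. card (A g n)) + card S * card (V n - E K n)) * ennreal (1 / real (card (V n)))"
      using card_W by (intro mult_right_mono of_nat_mono) auto
    also have "\<dots> = ?f n"
      by (simp add: emeasure_M[OF An] emeasure_M[OF Diff_subset] distrib_right sum_distrib_right mult.assoc)
    finally show ?thesis .
  qed
  then show "\<forall>\<^sub>F n in \<uu>. chain_cost \<le> ?f n" by simp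
qed

lemma chain_cost_le: "chain_cost \<le> action_cost G Mu uact"
  unfolding action_cost_def groupoid_cost_def
proof (rule INF_greatest, clarify)
  fix I :: "nat set" and \<phi>
  assume I: "graphing (action_groupoid G Mu uact) I \<phi>" "generating (action_groupoid G Mu uact) I \<phi>"
  let ?U = "\<Union>i\<in>I. \<phi> i"
  let ?B = "\<lambda>g. {c \<in> loeb.X. (g, c) \<in> ?U}"
  have "?U \<in> sets (count_space (carrier G) \<Otimes>\<^sub>M Mu)"
    using I(1) by (intro sets.countable_UN') (auto simp: graphing_def bisection_def)
  from sets_slice[OF this] have B: "?B g \<in> loeb_sets \<uu> M" for g
    by (simp add: loeb.space_loeb loeb.sets_loeb)
  then have "\<forall>g. \<exists>A. A \<in> loeb.msets \<and> loeb.out (sym_diff (?B g) (loeb.I A)) = 0"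
    by (simp add: loeb.loeb_sets_eq Bex_def)
  from choice[OF this] obtain A
    where *: "\<forall>g. A g \<in> loeb.msets \<and> loeb.out (sym_diff (?B g) (loeb.I (A g))) = 0" ..
  have A: "A g \<in> loeb.msets" "loeb.out (sym_diff (?B g) (loeb.I (A g))) = 0" for g
    by (rule conjunct1[OF spec[OF *]], rule conjunct2[OF spec[OF *]])
  \<comment> \<open>An internal representative exceeds its slice only by a null set.\<close>
  have mA: "loeb.m (A g) \<le> emeasure Mu (?B g)" for g
  proof -
    have "loeb.m (A g) = loeb.out (loeb.I (A g))" by (rule loeb.outer_I[OF A(1), symmetric])
    also have "\<dots> \<le> loeb.out (?B g \<union> sym_diff (?B g) (loeb.I (A g)))" by (rule loeb.outer_mono) auto
    also have "\<dots> \<le> loeb.out (?B g) + loeb.out (sym_diff (?B g) (loeb.I (A g)))" by (rule loeb.out_Un)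
    also have "\<dots> = emeasure Mu (?B g)" unfolding A(2) loeb.emeasure_loeb[OF B] by simp
    finally show ?thesis .
  qed
  let ?E = "\<lambda>K n. {x \<in> V n. \<forall>s\<in>S. (s, x) \<in> words G (V n) act {(g, y). g \<in> word_ball G S K \<and> y \<in> A g n} K}"
  let ?c = "graphing_cost (action_groupoid G Mu uact) I \<phi>"
  have le: "chain_cost \<le> ?c + of_nat (card S) * loeb.m (\<lambda>n. V n - ?E K n)" for K
  proof -
    have "(\<Sum>g\<in>word_ball G S K. loeb.m (A g)) \<le> (\<Sum>g\<in>word_ball G S K. emeasure Mu (?B g))"
      by (rule sum_mono) (rule mA)
    also have "\<dots> \<le> ?c"
      by (intro sum_slices_le_graphing_cost I(1) finite_word_ball finite_generators
          word_ball_closed generators_closed)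
    finally show ?thesis
      using chain_cost_le_truncation[of A K, OF A(1)] by (meson add_right_mono order_trans)
  qed
  \<comment> \<open>The slices cost at most \<open>?c\<close> for every K, so K occurs only in the
    repair term, whose coefficient is finite.\<close>
  have "(\<lambda>K. ?c + of_nat (card S) * loeb.m (\<lambda>n. V n - ?E K n)) \<longlonglongrightarrow> ?c + of_nat (card S) * 0"
    by (intro tendsto_add tendsto_const ennreal_tendsto_cmult generating_truncation[OF I A])
      (simp add: of_nat_less_top)
  then show "chain_cost \<le> ?c" using le by (intro LIMSEQ_le_const) auto
qed

lemma action_cost_uact: "action_cost G Mu uact = chain_cost"
proof (rule antisym)
  show "action_cost G Mu uact \<le> chain_cost"
    unfolding chain_cost_def by (intro INF_greatest action_cost_uact_le)
qed (rule chain_cost_le)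

end

theorem corollary1p5:
  fixes G :: "('g, 'b) monoid_scheme"
    and S :: "'g set"
    and H :: "nat \<Rightarrow> 'g set"
    and \<uu> :: "nat filter"
  assumes "group G"
    and "finite S" and "S \<subseteq> carrier G" and "generate G S = carrier G"
    and "farber_sequence G H" and "nested_sequence H"
    and "nonprincipal_ultrafilter \<uu>"
  shows "action_cost G
           (loeb_measure \<uu> (\<lambda>n. coset_measure G (H n)))
           (ultraproduct_action \<uu> (\<lambda>n. coset_measure G (H n)) (\<lambda>n. coset_action G))
         = ultra_combinatorial_cost \<uu> G S (\<lambda>n. coset_measure G (H n)) (\<lambda>n. coset_action G)
       \<and> ultra_combinatorial_cost \<uu> G S (\<lambda>n. coset_measure G (H n)) (\<lambda>n. coset_action G)
         = combinatorial_cost (\<lambda>n. lcosets\<^bsub>G\<^esub> (H n)) (\<lambda>n. schreier_edges G (H n) S)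
       \<and> (\<lambda>n. action_cost G (coset_measure G (H n)) (coset_action G))
         \<longlonglongrightarrow> combinatorial_cost (\<lambda>n. lcosets\<^bsub>G\<^esub> (H n)) (\<lambda>n. schreier_edges G (H n) S)"
proof -
  interpret ultra_chain G S H \<uu>
    using assms by (intro ultra_chain.intro farber_chain.intro generated_group.intro
        ultra_chain_axioms.intro farber_chain_axioms.intro generated_group_axioms.intro)
  show ?thesis
    using action_cost_tendsto
    by (simp add: action_cost_uact ultra_combinatorial_cost_eq[OF ultrafilter] combinatorial_cost_eq)
qed

end
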